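(* The two knots in each of the following pairs have the same Alexander polynomial, but they can be distinguished by linear Alexander quandles. In each pair the first knot is type I and the second is type II, and for the listed values of $n$ and $m$ the linear Alexander quandle $Q=\mathbb{Z}_n[t,t^{-1}]/(t-m)$ distinguishes the two knots, i.e. their numbers of colourings $C_Q$ are different: - $6_{1}$ and $9_{46}$ ($n=3$, $m=2$) - $8_{9}$ and $10_{155}$ ($n=5$, $m=4$) - $9_{24}$ and $8_{18}$ ($n=6$, $m=5$) - $10_{40}$ and $10_{103}$ ($n=5$, $m=4$) - $10_{42}$ and $10_{75}$ ($n=3$, $m=2$) - $10_{59}$ and $9_{40}$ ($n=5$, $m=4$) - $10_{67}$ and $10_{74}$ ($n=3$, $m=2$) - $10_{87}$ and $10_{98}$ ($n=3$, $m=2$)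
   Context: **Knot names.** Knots are named as in Rolfsen's table of prime knots up to ten crossings. **Linear finite Alexander quandle.** For coprime integers $n\ge 1$ and $m$, the quandle $Q=\mathbb{Z}_n[t,t^{-1}]/(t-m)$ is identified with $\mathbb{Z}_n$, with operations $a\ast b=ma+(1-m)b$ and $a\ast' b=m^{-1}a+(1-m^{-1})b$ modulo $n$. **Colourings.** Let $D$ be an oriented diagram of a knot $K$ with $N\ge1$ crossings, hence $N$ arcs. A colouring of $D$ by $Q$ assigns $X_k\in Q$ to each arc $k$ so that at each crossing with incoming under-arc $i$, outgoing under-arc $i'$ and over-arc $j$: $X_{i'}=X_i\ast X_j$ if the crossing is positive (right-handed), $X_{i'}=X_i\ast' X_j$ if it is negative (left-handed). $C_Q(K)$ is the number of colourings; it does not depend on the diagram of $K$. **Colouring matrix.** The $N\times N$ matrix over $\mathbb{Z}[m,m^{-1}]$ ($m$ regarded as an indeterminate), one row per crossing, encoding $mX_i+(1-m)X_j-X_{i'}=0$ (positive crossing) or $m^{-1}X_i+(1-m^{-1})X_j-X_{i'}=0$ (negative crossing); if some of $i,i',j$ coincide the corresponding entries are added. **Equivalent matrices.** $B$ is equivalent to a colouring matrix $A$ if it is obtained from $A$ by finitely many operations of the following kinds: (a) multiplying a row by $m$, $m^{-1}$ or $-1$; (b) replacing a row by its sum with another row; (c) swapping two rows; (d) swapping two columns. **Type I and type II.** An $N\times N$ matrix is of type I if it is upper triangular with diagonal $(1,\dots,1,\alpha(m),0)$, its row $N-1$ is $(0,\dots,0,\alpha(m),-\alpha(m))$, and its last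 row is zero. It is of type II if it is upper triangular with diagonal $(1,\dots,1,\alpha_1(m),\alpha_2(m),0)$, its row $N-2$ is $(0,\dots,0,\alpha_1(m),\beta_1(m),-(\alpha_1(m)+\beta_1(m)))$, its row $N-1$ is $(0,\dots,0,\alpha_2(m),-\alpha_2(m))$, and its last row is zero. Other above-diagonal entries are arbitrary. A knot is type I (resp. type II) if it has a colouring matrix equivalent to a matrix of type I (resp. type II). **Alexander polynomial.** The determinant of the matrix obtained from a colouring matrix by deleting the last row and column, defined up to multiplication by $\pm m^k$. *)

theory Defs
  imports
    "HOL-Library.FuncSet"
    "HOL-Library.Poly_Mapping"
    "HOL-Combinatorics.Orbits"
    "HOL-Number_Theory.Modular_Inverse"
    "Jordan_Normal_Form.Determinant"
    "Jordan_Normal_Form.Column_Operations"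
begin

section \<open>Oriented knot diagrams\<close>

text \<open>
  An oriented knot diagram is given by its signed Gauss code: walking once around the knot along its
  orientation, one records for every passage through a crossing whether it is the over- or the
  under-passage, the label of the crossing, and whether the crossing is positive. The list is read
  cyclically.
\<close>

datatype level = Over | Under

type_synonym passage = "level \<times> nat \<times> bool"
type_synonym gauss = "passage list"

fun opposite :: "level \<Rightarrow> level" where
  "opposite Over = Under"
| "opposite Under = Over"

definition crossings :: "gauss \<Rightarrow> nat set" where
  "crossings D = (\<lambda>(l, c, s). c) ` set D"

definition positive :: "gauss \<Rightarrow> nat \<Rightarrow> bool" where
  "positive D c \<longleftrightarrow> (Under, c, True) \<in> set D"

definition position :: "gauss \<Rightarrow> level \<Rightarrow> nat \<Rightarrow> nat" where
  "position D l c = (THE i. i < length D \<and> (\<exists>s. D ! i = (l, c, s)))"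

text \<open>
  Edge \<open>i\<close> leads from passage \<open>i\<close> to passage \<open>i + 1\<close> (cyclically), and \<open>(i, True)\<close>, \<open>(i, False)\<close> are the
  two ways of walking along it. A walk that turns left at every crossing goes around a face. At a
  positive crossing the under-strand passes from the right to the left of the over-strand, so
  somebody arriving on the over-strand in its direction leaves along the outgoing under-edge; the
  other cases follow by changing the sign, the strand or the direction.
\<close>

fun turn_left :: "gauss \<Rightarrow> nat \<times> bool \<Rightarrow> nat \<times> bool" where
  "turn_left D (i, forward) =
     (let (l, c, s) = D ! (if forward then Suc i mod length D else i);
          j = position D (opposite l) c
      in if forward \<longleftrightarrow> ((l = Over) \<longleftrightarrow> s) then (j, True)
         else ((j + length D - 1) mod length D, False))"

definition faces :: "gauss \<Rightarrow> (nat \<times> bool) set set" where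
  "faces D = orbit (turn_left D) ` ({..<length D} \<times> UNIV)"

text \<open>
  The last condition says that the diagram lies on the sphere: with \<open>N\<close> vertices and \<open>2 N\<close> edges,
  Euler's formula amounts to \<open>N + 2\<close> faces.
\<close>

definition knot_diagram :: "gauss \<Rightarrow> bool" where
  "knot_diagram D \<longleftrightarrow>
     D \<noteq> [] \<and>
     distinct (map (\<lambda>(l, c, s). (l, c)) D) \<and>
     (\<forall>c s. (Over, c, s) \<in> set D \<longleftrightarrow> (Under, c, s) \<in> set D) \<and>
     card (faces D) = card (crossings D) + 2"


section \<open>Knots\<close>

text \<open>
  The three strands of a third Reidemeister move: the top strand \<open>T\<close> crosses the middle strand \<open>M\<close> at
  \<open>a\<close> and the bottom strand \<open>B\<close> at \<open>b\<close>, and \<open>M\<close> crosses \<open>B\<close> at \<open>c\<close>; \<open>e1\<close>, \<open>e2\<close>, \<open>e3\<close> give the order in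
  which each strand meets its two crossings. If these booleans and the signs are read as \<open>+1\<close>, \<open>-1\<close>,
  the last two conditions say \<open>e1 e2 sa = e1 e3 sb = e2 e3 sc\<close>. This holds for three oriented straight
  lines in the plane, and it characterizes the case in which the three strands bound a triangular
  face.
\<close>

definition triangle :: "gauss \<Rightarrow> gauss \<Rightarrow> gauss \<Rightarrow> bool" where
  "triangle T M B \<longleftrightarrow>
     (\<exists>a b c sa sb sc e1 e2 e3.
        T = (if e1 then id else rev) [(Over, a, sa), (Over, b, sb)] \<and>
        M = (if e2 then id else rev) [(Under, a, sa), (Over, c, sc)] \<and>
        B = (if e3 then id else rev) [(Under, b, sb), (Under, c, sc)] \<and>
        ((e2 \<longleftrightarrow> sa) \<longleftrightarrow> (e3 \<longleftrightarrow> sb)) \<and>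
        ((e1 \<longleftrightarrow> sb) \<longleftrightarrow> (e2 \<longleftrightarrow> sc)))"

text \<open>
  The two crossings of \<open>R2\<close> have opposite signs, so the two new edges between them bound a bigon, and
  \<open>R2\<close> between diagrams on the sphere is the geometric move. Reversing the orientation is allowed
  because knots are not oriented; mirror images are not identified.
\<close>

inductive move :: "gauss \<Rightarrow> gauss \<Rightarrow> bool" where
  base_point: "move (xs @ ys) (ys @ xs)"
| relabel: "inj_on f (crossings D) \<Longrightarrow> move D (map (\<lambda>(l, c, s). (l, f c, s)) D)"
| reverse: "move D (rev D)"
| R1: "c \<notin> crossings D \<Longrightarrow> move D ([(l, c, s), (opposite l, c, s)] @ D)"
| R2: "a \<noteq> b \<Longrightarrow> a \<notin> crossings (xs @ ys) \<Longrightarrow> b \<notin> crossings (xs @ ys) \<Longrightarrow>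
    us = [(Under, a, s), (Under, b, \<not> s)] \<or> us = [(Under, b, \<not> s), (Under, a, s)] \<Longrightarrow>
    move (xs @ ys) ([(Over, a, s), (Over, b, \<not> s)] @ xs @ us @ ys)"
| R3_top_middle_bottom: "triangle T M B \<Longrightarrow>
    move (T @ xs @ M @ ys @ B @ zs) (rev T @ xs @ rev M @ ys @ rev B @ zs)"
| R3_top_bottom_middle: "triangle T M B \<Longrightarrow>
    move (T @ xs @ B @ ys @ M @ zs) (rev T @ xs @ rev B @ ys @ rev M @ zs)"

definition diagram_move :: "gauss \<Rightarrow> gauss \<Rightarrow> bool" where
  "diagram_move D D' \<longleftrightarrow> knot_diagram D \<and> knot_diagram D' \<and> move D D'"

text \<open>
  A knot is the set of all its oriented diagrams with at least one crossing. (Excluding the diagram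
  without crossings does not affect the equivalence: diagrams that it connects are also connected
  through curls.)
\<close>

definition knot :: "gauss \<Rightarrow> gauss set" where
  "knot D = {D'. knot_diagram D' \<and> equivclp diagram_move D D'}"


section \<open>Colourings\<close>

text \<open>
  An arc is named after the crossing at which it starts, i.e. whose outgoing under-arc it is. Passage
  \<open>i\<close> is reached along the arc that starts at the last under-passage cyclically before \<open>i\<close>.
\<close>

definition arc_into :: "gauss \<Rightarrow> nat \<Rightarrow> nat" where
  "arc_into D i = fst (snd (last (filter (\<lambda>p. fst p = Under) (rotate i D))))"

definition under_in :: "gauss \<Rightarrow> nat \<Rightarrow> nat" where
  "under_in D c = arc_into D (position D Under c)"

definition over_arc :: "gauss \<Rightarrow> nat \<Rightarrow> nat" where
  "over_arc D c = arc_into D (position D Over c)"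

definition quandle_op :: "int \<Rightarrow> int \<Rightarrow> int \<Rightarrow> int \<Rightarrow> int" where
  "quandle_op n m a b = (m * a + (1 - m) * b) mod n"

definition quandle_op' :: "int \<Rightarrow> int \<Rightarrow> int \<Rightarrow> int \<Rightarrow> int" where
  "quandle_op' n m a b = (modular_inverse n m * a + (1 - modular_inverse n m) * b) mod n"

definition colourings :: "int \<Rightarrow> int \<Rightarrow> gauss \<Rightarrow> (nat \<Rightarrow> int) set" where
  "colourings n m D =
     {X \<in> crossings D \<rightarrow>\<^sub>E {0..<n}.
        \<forall>c \<in> crossings D.
          X c = (if positive D c then quandle_op n m else quandle_op' n m)
                  (X (under_in D c)) (X (over_arc D c))}"

definition distinguishes :: "int \<Rightarrow> int \<Rightarrow> gauss set \<Rightarrow> gauss set \<Rightarrow> bool" where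
  "distinguishes n m K K' \<longleftrightarrow>
     n \<ge> 1 \<and> coprime n m \<and>
     (\<forall>D \<in> K. \<forall>D' \<in> K'. card (colourings n m D) \<noteq> card (colourings n m D'))"


section \<open>Colouring matrices\<close>

text \<open>The monoid algebra of the integers over the integers: Laurent polynomials in \<open>m\<close>.\<close>

type_synonym laurent = "int \<Rightarrow>\<^sub>0 int"

definition mpow :: "int \<Rightarrow> laurent" where
  "mpow k = Poly_Mapping.single k 1"

text \<open>Rows are numbered by the list \<open>rs\<close> of crossings and columns by the list \<open>cs\<close> of arcs.\<close>

definition matrix_of_numbering :: "gauss \<Rightarrow> nat list \<Rightarrow> nat list \<Rightarrow> laurent mat" where
  "matrix_of_numbering D rs cs =
     mat (length rs) (length cs) (\<lambda>(k, l).
       let c = rs ! k; a = cs ! l; u = mpow (if positive D c then 1 else -1)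
       in (if a = under_in D c then u else 0)
          + (if a = over_arc D c then 1 - u else 0)
          - (if a = c then 1 else 0))"

definition colouring_matrix :: "gauss \<Rightarrow> laurent mat \<Rightarrow> bool" where
  "colouring_matrix D A \<longleftrightarrow>
     (\<exists>rs cs. distinct rs \<and> set rs = crossings D \<and> distinct cs \<and> set cs = crossings D \<and>
        A = matrix_of_numbering D rs cs)"

inductive matrix_step :: "laurent mat \<Rightarrow> laurent mat \<Rightarrow> bool" where
  "k < dim_row A \<Longrightarrow> u \<in> {mpow 1, mpow (-1), -1} \<Longrightarrow> matrix_step A (multrow k u A)"
| "k < dim_row A \<Longrightarrow> l < dim_row A \<Longrightarrow> k \<noteq> l \<Longrightarrow> matrix_step A (addrow 1 k l A)"
| "k < dim_row A \<Longrightarrow> l < dim_row A \<Longrightarrow> matrix_step A (swaprows k l A)"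
| "k < dim_col A \<Longrightarrow> l < dim_col A \<Longrightarrow> matrix_step A (swapcols k l A)"

definition matrix_equivalent :: "laurent mat \<Rightarrow> laurent mat \<Rightarrow> bool" where
  "matrix_equivalent = matrix_step\<^sup>*\<^sup>*"

text \<open>Rows and columns are counted from \<open>0\<close> here, so row \<open>N - 1\<close> of an \<open>N \<times> N\<close> matrix is the last one.\<close>

definition type_I_matrix :: "laurent mat \<Rightarrow> bool" where
  "type_I_matrix A \<longleftrightarrow>
     (\<exists>N \<alpha>. N \<ge> 2 \<and> A \<in> carrier_mat N N \<and> upper_triangular A \<and>
        (\<forall>i < N - 2. A $$ (i, i) = 1) \<and>
        A $$ (N - 2, N - 2) = \<alpha> \<and> A $$ (N - 2, N - 1) = - \<alpha> \<and>
        A $$ (N - 1, N - 1) = 0)"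

definition type_II_matrix :: "laurent mat \<Rightarrow> bool" where
  "type_II_matrix A \<longleftrightarrow>
     (\<exists>N \<alpha>\<^sub>1 \<beta>\<^sub>1 \<alpha>\<^sub>2. N \<ge> 3 \<and> A \<in> carrier_mat N N \<and> upper_triangular A \<and>
        (\<forall>i < N - 3. A $$ (i, i) = 1) \<and>
        A $$ (N - 3, N - 3) = \<alpha>\<^sub>1 \<and> A $$ (N - 3, N - 2) = \<beta>\<^sub>1 \<and>
        A $$ (N - 3, N - 1) = - (\<alpha>\<^sub>1 + \<beta>\<^sub>1) \<and>
        A $$ (N - 2, N - 2) = \<alpha>\<^sub>2 \<and> A $$ (N - 2, N - 1) = - \<alpha>\<^sub>2 \<and>
        A $$ (N - 1, N - 1) = 0)"

definition type_I :: "gauss set \<Rightarrow> bool" where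
  "type_I K \<longleftrightarrow>
     (\<exists>D \<in> K. \<exists>A B. colouring_matrix D A \<and> matrix_equivalent A B \<and> type_I_matrix B)"

definition type_II :: "gauss set \<Rightarrow> bool" where
  "type_II K \<longleftrightarrow>
     (\<exists>D \<in> K. \<exists>A B. colouring_matrix D A \<and> matrix_equivalent A B \<and> type_II_matrix B)"

definition alexander_polynomial :: "gauss set \<Rightarrow> laurent \<Rightarrow> bool" where
  "alexander_polynomial K p \<longleftrightarrow>
     (\<exists>D \<in> K. \<exists>A u k. colouring_matrix D A \<and> u \<in> {1, -1} \<and>
        p = u * mpow k * det (mat_delete A (dim_row A - 1) (dim_col A - 1)))"

definition same_alexander_polynomial :: "gauss set \<Rightarrow> gauss set \<Rightarrow> bool" where
  "same_alexander_polynomial K K' \<longleftrightarrow>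
     (\<exists>p. alexander_polynomial K p \<and> alexander_polynomial K' p)"


section \<open>Knots from Rolfsen's table\<close>

text \<open>
  In the lists below \<open>c\<close> stands for the over-passage and \<open>-c\<close> for the under-passage of crossing \<open>c\<close>; the
  second list contains the negative crossings. Each knot is given by a diagram with the minimal number
  of crossings, drawn from the Conway notation stated with it. The table does not distinguish mirror
  images, and either choice is allowed here: mirroring a diagram exchanges \<open>m\<close> and \<open>m\<^sup>-\<^sup>1\<close> in the colouring
  matrix and in the quandle, which preserves both types, and every value of \<open>m\<close> used with these knots
  is its own inverse modulo \<open>n\<close>.
\<close>

definition signed_gauss :: "int list \<Rightarrow> nat list \<Rightarrow> gauss" where
  "signed_gauss xs ns =
     map (\<lambda>x. (if x > 0 then Over else Under, nat \<bar>x\<bar>, nat \<bar>x\<bar> \<notin> set ns)) xs"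

text \<open>Conway notation: 4 2\<close>
definition knot_6_1 :: "gauss set" where
  "knot_6_1 = knot (signed_gauss
     [-1, 2, -3, 1, -4, 5, -6, 3, -2, 6, -5, 4]
     [1, 4, 5, 6])"

text \<open>Conway notation: 3 1 1 3\<close>
definition knot_8_9 :: "gauss set" where
  "knot_8_9 = knot (signed_gauss
     [-1, 2, -3, 4, -5, 6, -7, 1, -8, 5, -2, 3, -4, 8, -6, 7]
     [2, 3, 4, 5])"

text \<open>Conway notation: 8*\<close>
definition knot_8_18 :: "gauss set" where
  "knot_8_18 = knot (signed_gauss
     [-1, 2, -3, 4, -5, 1, -6, 3, -7, 5, -8, 6, -2, 7, -4, 8]
     [3, 4, 6, 8])"

text \<open>Conway notation: 3, 2 1, 2+\<close>
definition knot_9_24 :: "gauss set" where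
  "knot_9_24 = knot (signed_gauss
     [-1, 2, -3, 4, -2, 5, -6, 1, -7, 8, -4, 3, -9, 7, -8, 9, -5, 6]
     [3, 4, 7, 8, 9])"

text \<open>Conway notation: 9*\<close>
definition knot_9_40 :: "gauss set" where
  "knot_9_40 = knot (signed_gauss
     [-1, 2, -3, 4, -5, 1, -6, 7, -4, 8, -2, 6, -9, 5, -8, 3, -7, 9]
     [1, 3, 4, 6, 8, 9])"

text \<open>Conway notation: 3, 3, 2 1-, drawn as the pretzel knot (3, 3, -3)\<close>
definition knot_9_46 :: "gauss set" where
  "knot_9_46 = knot (signed_gauss
     [-1, -2, 3, -4, -5, 6, -7, 1, -8, 9, 4, -3, 2, 7, -6, 5, -9, 8]
     [1, 5, 6, 7, 8, 9])"

text \<open>Conway notation: 2 2 2 1 1 2\<close>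
definition knot_10_40 :: "gauss set" where
  "knot_10_40 = knot (signed_gauss
     [-1, 2, -3, 4, -5, 6, -7, 8, -9, 1, -8, 7, -4, 10, -2, 3, -10, 5, -6, 9]
     [2, 3, 10])"

text \<open>Conway notation: 2 2 1 1 1 1 2\<close>
definition knot_10_42 :: "gauss set" where
  "knot_10_42 = knot (signed_gauss
     [-1, 2, -3, 4, -5, 6, -7, 1, -8, 7, -6, 9, -4, 10, -2, 3, -10, 5, -9, 8]
     [2, 3, 6, 7, 10])"

text \<open>Conway notation: 2 2, 2 1 1, 2\<close>
definition knot_10_59 :: "gauss set" where
  "knot_10_59 = knot (signed_gauss
     [-1, 2, -3, 4, -5, 1, -6, 5, -4, 7, -8, 9, -10, 8, -2, 3, -7, 10, -9, 6]
     [4, 5, 9, 10])"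

text \<open>Conway notation: 2 2, 3, 2 1\<close>
definition knot_10_67 :: "gauss set" where
  "knot_10_67 = knot (signed_gauss
     [-1, 2, -3, 4, -5, 6, -7, 8, -9, 1, -8, 7, -10, 3, -2, 10, -6, 5, -4, 9]
     [1, 4, 5, 6, 7, 8, 9, 10])"

text \<open>Conway notation: 3, 3, 2 1+\<close>
definition knot_10_74 :: "gauss set" where
  "knot_10_74 = knot (signed_gauss
     [-1, 2, -3, 4, -5, 3, -6, 7, -8, 1, -9, 10, -2, 5, -4, 8, -7, 6, -10, 9]
     [1, 2, 3, 6, 7, 8, 9, 10])"

text \<open>Conway notation: 2 1, 2 1, 2 1+\<close>
definition knot_10_75 :: "gauss set" where
  "knot_10_75 = knot (signed_gauss
     [-1, 2, -3, 4, -5, 3, -6, 7, -8, 6, -9, 1, -10, 9, -2, 5, -4, 8, -7, 10]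
     [2, 3, 6, 9])"

text \<open>Conway notation: . 2 2 . 2 0\<close>
definition knot_10_87 :: "gauss set" where
  "knot_10_87 = knot (signed_gauss
     [-1, 2, -3, 4, -5, 1, -6, 3, -4, 7, -8, 5, -2, 6, -9, 10, -7, 8, -10, 9]
     [2, 3, 4, 5])"

text \<open>Conway notation: . 2 . 2 . 2 . 2 0\<close>
definition knot_10_98 :: "gauss set" where
  "knot_10_98 = knot (signed_gauss
     [-1, 2, -3, 4, -5, 6, -7, 8, -9, 3, -4, 7, -10, 1, -6, 5, -2, 9, -8, 10]
     [1, 2, 3, 4, 5, 6, 7, 10])"

text \<open>Conway notation: 3 0 : 2 : 2\<close>
definition knot_10_103 :: "gauss set" where
  "knot_10_103 = knot (signed_gauss
     [-1, 2, -3, 4, -5, 6, -2, 7, -8, 3, -6, 1, -9, 10, -7, 8, -4, 5, -10, 9]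
     [1, 4, 5, 7, 8, 9, 10])"

text \<open>Conway notation: -3 : 2 : 2\<close>
definition knot_10_155 :: "gauss set" where
  "knot_10_155 = knot (signed_gauss
     [-1, -2, 3, -4, -5, 6, -7, 8, 2, -3, 4, 9, -10, 7, -8, 1, -9, 5, -6, 10]
     [1, 2, 3, 4, 9, 10])"

end

theory Submission
  imports Defs
begin

text \<open>
  In all cases \<open>m = -1\<close> modulo \<open>n\<close>, so both quandle operations are \<open>2 b - a\<close>: the colourings are Fox
  colourings, for which signs and orientations play no role, and their number is easily seen to be
  invariant under all moves. Row reduction of one colouring matrix of each knot over the
  polynomials in \<open>m\<close> yields its type and, as the product of the diagonal, its Alexander polynomial.
  Setting \<open>m = -1\<close> in the reduced matrix of a type I knot shows that a colouring is determined by
  two of its values, so there are at most \<open>n\<^sup>2\<close> of them; each of the type II knots has an explicit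
  family of more than \<open>n\<^sup>2\<close> colourings.
\<close>

text \<open>\<open>type_I\<close>, \<open>type_II\<close> and \<open>alexander_polynomial\<close>
  ask for one diagram of the knot, whereas \<open>distinguishes\<close> speaks about all of them, so
  the number of colourings has to be followed through the moves. Arcs are named after crossings, and
  a move may split or rename them; counting closed walks instead keeps the change local.

  The reductions are certificates: lists of integer coefficients, replayed by evaluation. The same
  lists are read at \<open>m\<close> over the Laurent polynomials, for the types and the Alexander
  polynomial, and at -1 over the integers, for the bound on the colourings. Every row of a colouring
  matrix sums to zero, because constant maps are colourings; this is where the prescribed entries in
  the last column of types I and II come from.

  Both counts are only bounded: at most n^2 against at least n p^2, where p is a prime factor of n.
  For the type II knots of the list, both nontrivial rows vanish modulo p at m = -1, which leaves
  three values free modulo p.\<close>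

section \<open>Invariance of the number of Fox colourings\<close>

text \<open>
  \<open>walk n W x D y\<close> means that a walk along \<open>D\<close> that starts on an arc of colour \<open>x\<close> ends on an arc of
  colour \<open>y\<close>, provided that the over-strand at each crossing \<open>c\<close> has colour \<open>W c\<close>. This describes
  colourings in a way that is compositional in \<open>D\<close>.
\<close>

fun walk :: "int \<Rightarrow> (nat \<Rightarrow> int) \<Rightarrow> int \<Rightarrow> gauss \<Rightarrow> int \<Rightarrow> bool" where
  "walk n W x [] y \<longleftrightarrow> x = y"
| "walk n W x ((Over, c, s) # D) y \<longleftrightarrow> W c = x \<and> walk n W x D y"
| "walk n W x ((Under, c, s) # D) y \<longleftrightarrow> walk n W ((2 * W c - x) mod n) D y"

text \<open>The over-strand colours \<open>W\<close> are chosen in advance and confirmed at each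
  over-passage, so that a walk never looks ahead; \<open>x\<close> is the colour at the base point.
  Extensional functions make the set finite, so that its cardinality is meaningful.\<close>

definition loops :: "int \<Rightarrow> gauss \<Rightarrow> ((nat \<Rightarrow> int) \<times> int) set" where
  "loops n D = {(W, x). W \<in> crossings D \<rightarrow>\<^sub>E {0..<n} \<and> x \<in> {0..<n} \<and> walk n W x D x}"

lemma crossings_simps [simp]:
  "crossings [] = {}"
  "crossings ((l, c, s) # D) = insert c (crossings D)"
  "crossings (xs @ ys) = crossings xs \<union> crossings ys"
  "crossings (rev xs) = crossings xs"
  by (simp_all add: crossings_def image_Un)

lemma finite_crossings [simp]: "finite (crossings D)"
  by (simp add: crossings_def)

lemma finite_loops: "finite (loops n D)"
proof (rule finite_subset)
  show "loops n D \<subseteq> (crossings D \<rightarrow>\<^sub>E {0..<n}) \<times> {0..<n}"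
    by (auto simp: loops_def)
  show "finite ((crossings D \<rightarrow>\<^sub>E {0..<n}) \<times> {0..<n})"
    by (intro finite_cartesian_product finite_PiE) auto
qed

lemma walk_append: "walk n W x (xs @ ys) y \<longleftrightarrow> (\<exists>z. walk n W x xs z \<and> walk n W z ys y)"
  by (induction n W x xs y rule: walk.induct) auto

lemma walk_unique: "walk n W x D y \<Longrightarrow> walk n W x D z \<Longrightarrow> y = z"
  by (induction n W x D y rule: walk.induct) auto

lemma walk_range: "walk n W x D y \<Longrightarrow> x \<in> {0..<n} \<Longrightarrow> y \<in> {0..<n}"
  by (induction n W x D y rule: walk.induct) auto

lemma walk_cong:
  "(\<And>c. c \<in> crossings D \<Longrightarrow> W c = W' c) \<Longrightarrow> walk n W x D y \<longleftrightarrow> walk n W' x D y"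
  by (induction n W x D y rule: walk.induct) auto

text \<open>Passing under a strand of colour \<open>w\<close> is a reflection, hence an involution;
  reversal and curls rest on this.\<close>

lemma reflect_eq_iff:
  fixes n w x y :: int
  assumes "x \<in> {0..<n}" "y \<in> {0..<n}"
  shows "(2 * w - x) mod n = y \<longleftrightarrow> (2 * w - y) mod n = x"
  using assms by (auto simp: mod_diff_right_eq)

lemma walk_rev:
  "x \<in> {0..<n} \<Longrightarrow> y \<in> {0..<n} \<Longrightarrow> walk n W x (rev D) y \<longleftrightarrow> walk n W y D x"
proof (induction n W y D x arbitrary: rule: walk.induct)
  case (3 n W y c s D x)
  have z: "(2 * W c - y) mod n \<in> {0..<n}"
    using 3 by auto
  have "walk n W x (rev ((Under, c, s) # D)) y \<longleftrightarrow>
      (\<exists>z. walk n W x (rev D) z \<and> (2 * W c - z) mod n = y)"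
    by (simp add: walk_append)
  also have "\<dots> \<longleftrightarrow> walk n W x (rev D) ((2 * W c - y) mod n)"
    using 3(2,3) z walk_range[of n W x "rev D"] reflect_eq_iff[of _ n y "W c"] by metis
  finally show ?case
    using 3 z by simp
qed (auto simp: walk_append)

section \<open>The number of loops under each move\<close>

lemma loops_base_point_le: "card (loops n (xs @ ys)) \<le> card (loops n (ys @ xs))"
proof -
  \<comment> \<open>\<open>f\<close> moves the base point past \<open>xs\<close>. The image
    \<open>(W, y)\<close> determines \<open>x\<close> by walking along \<open>ys\<close>, which
    gives injectivity. Used again with \<open>xs\<close> and \<open>ys\<close> exchanged, the
    inequality becomes an equality.\<close>
  define f where "f = (\<lambda>(W, x). (W :: nat \<Rightarrow> int, SOME y. walk n W x xs y \<and> walk n W y ys x))"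
  have f: "\<exists>y. f (W, x) = (W, y) \<and> walk n W x xs y \<and> walk n W y ys x"
    if "(W, x) \<in> loops n (xs @ ys)" for W x
  proof -
    have "\<exists>y. walk n W x xs y \<and> walk n W y ys x"
      using that by (simp add: loops_def walk_append)
    from someI_ex[OF this] show ?thesis
      by (simp add: f_def)
  qed
  show ?thesis
  proof (rule card_inj_on_le[OF _ _ finite_loops])
    show "inj_on f (loops n (xs @ ys))"
    proof (rule inj_onI)
      fix p q assume "p \<in> loops n (xs @ ys)" "q \<in> loops n (xs @ ys)" "f p = f q"
      then show "p = q"
        using f[of "fst p" "snd p"] f[of "fst q" "snd q"] walk_unique
        by (metis prod.collapse prod.inject)
    qed
    show "f ` loops n (xs @ ys) \<subseteq> loops n (ys @ xs)"
    proof
      fix q assume "q \<in> f ` loops n (xs @ ys)"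
      then obtain W x where Wx: "(W, x) \<in> loops n (xs @ ys)" "q = f (W, x)"
        by (metis image_iff surj_pair)
      obtain y where y: "f (W, x) = (W, y)" "walk n W x xs y" "walk n W y ys x"
        using f[OF Wx(1)] by blast
      have "y \<in> {0..<n}"
        using walk_range[OF y(2)] Wx by (simp add: loops_def)
      then show "q \<in> loops n (ys @ xs)"
        using Wx y by (auto simp: loops_def walk_append Un_commute)
    qed
  qed
qed

lemma card_loops_relabel:
  assumes inj: "inj_on f (crossings D)"
  shows "card (loops n (map (\<lambda>(l, c, s). (l, f c, s)) D)) = card (loops n D)"
proof -
  define D' where "D' = map (\<lambda>(l, c, s). (l, f c, s)) D"
  define g where "g = inv_into (crossings D) f"
  have walk_map: "walk n W x (map (\<lambda>(l, c, s). (l, f c, s)) E) y \<longleftrightarrow> walk n (W \<circ> f) x E y" for W x E y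
    by (induction n "W \<circ> f" x E y rule: walk.induct) auto
  have cr: "crossings D' = f ` crossings D"
    by (force simp: crossings_def D'_def)
  have gf: "g (f c) = c" if "c \<in> crossings D" for c
    using that inj by (simp add: g_def)
  have "bij_betw (\<lambda>(W, x). (restrict (W \<circ> f) (crossings D), x)) (loops n D') (loops n D)"
  proof (rule bij_betw_byWitness[where f' = "\<lambda>(W, x). (restrict (W \<circ> g) (crossings D'), x)"])
    show "\<forall>p\<in>loops n D'. (\<lambda>(W, x). (restrict (W \<circ> g) (crossings D'), x))
        ((\<lambda>(W, x). (restrict (W \<circ> f) (crossings D), x)) p) = p"
      by (force simp: loops_def cr gf PiE_def extensional_def fun_eq_iff)
    show "\<forall>p\<in>loops n D. (\<lambda>(W, x). (restrict (W \<circ> f) (crossings D), x))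
        ((\<lambda>(W, x). (restrict (W \<circ> g) (crossings D'), x)) p) = p"
      by (force simp: loops_def cr gf PiE_def extensional_def fun_eq_iff)
    show "(\<lambda>(W, x). (restrict (W \<circ> f) (crossings D), x)) ` loops n D' \<subseteq> loops n D"
    proof clarify
      fix W x assume W: "(W, x) \<in> loops n D'"
      then have "walk n (W \<circ> f) x D x"
        by (simp add: loops_def D'_def walk_map)
      then have "walk n (restrict (W \<circ> f) (crossings D)) x D x"
        by (subst walk_cong[where W' = "W \<circ> f"]) auto
      then show "(restrict (W \<circ> f) (crossings D), x) \<in> loops n D"
        using W by (auto simp: loops_def cr PiE_def Pi_def)
    qed
    show "(\<lambda>(W, x). (restrict (W \<circ> g) (crossings D'), x)) ` loops n D \<subseteq> loops n D'"
    proof clarify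
      fix W x assume W: "(W, x) \<in> loops n D"
      then have "walk n W x D x"
        by (simp add: loops_def)
      then have "walk n (restrict (W \<circ> g) (crossings D')) x D' x"
        unfolding D'_def walk_map
        by (subst walk_cong[where W' = W]) (auto simp: cr[unfolded D'_def] gf)
      then show "(restrict (W \<circ> g) (crossings D'), x) \<in> loops n D'"
        using W by (auto simp: loops_def cr gf PiE_def Pi_def)
    qed
  qed
  then show ?thesis
    unfolding D'_def[symmetric] by (rule bij_betw_same_card)
qed

lemma loops_rev: "loops n (rev D) = loops n D"
  by (auto simp: loops_def walk_rev)

lemma card_loops_R1:
  assumes c: "c \<notin> crossings D"
  shows "card (loops n ([(l, c, s), (opposite l, c, s)] @ D)) = card (loops n D)"
proof -
  let ?D = "[(l, c, s), (opposite l, c, s)] @ D"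
  have walk_upd: "walk n (W(c := w)) x D y \<longleftrightarrow> walk n W x D y" for W w x y
    using c by (intro walk_cong) auto
  have walk_restrict: "walk n (restrict W (crossings D)) x D y \<longleftrightarrow> walk n W x D y" for W x y
    by (intro walk_cong) auto
  have curl: "walk n W x ?D x \<longleftrightarrow> W c = x \<and> walk n W x D x"
    if "x \<in> {0..<n}" "W c \<in> {0..<n}" for W x
  proof -
    \<comment> \<open>If the curl starts with its under-passage, its over-strand is the arc just
      produced; the reflection in \<open>W c\<close> reaches \<open>W c\<close> only from
      \<open>W c\<close> itself.\<close>
    have "W c = (2 * W c - x) mod n \<longleftrightarrow> W c = x"
      using reflect_eq_iff[of x n "W c" "W c"] that by auto
    moreover have "(2 * x - x) mod n = x"
      using that by simp
    ultimately show ?thesis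
      by (cases l) (auto; metis)+
  qed
  have curled: "W c = x \<and> walk n W x D x" if "(W, x) \<in> loops n ?D" for W x
  proof -
    have "x \<in> {0..<n}" "W c \<in> {0..<n}" "walk n W x ?D x"
      using that by (auto simp: loops_def PiE_def Pi_def)
    then show ?thesis
      using curl by blast
  qed
  have "bij_betw (\<lambda>(W, x). (W(c := x), x)) (loops n D) (loops n ?D)"
  proof (rule bij_betw_byWitness[where f' = "\<lambda>(W, x). (restrict W (crossings D), x)"])
    show "\<forall>p\<in>loops n D. (\<lambda>(W, x). (restrict W (crossings D), x)) ((\<lambda>(W, x). (W(c := x), x)) p) = p"
      using c by (auto simp: loops_def PiE_def extensional_def fun_eq_iff)
    have "(restrict W (crossings D))(c := x) = W" if "(W, x) \<in> loops n ?D" for W x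
      using curled[OF that] that by (auto simp: loops_def PiE_def extensional_def fun_eq_iff)
    then show "\<forall>p\<in>loops n ?D. (\<lambda>(W, x). (W(c := x), x)) ((\<lambda>(W, x). (restrict W (crossings D), x)) p) = p"
      by auto
    show "(\<lambda>(W, x). (W(c := x), x)) ` loops n D \<subseteq> loops n ?D"
    proof clarify
      fix W x assume W: "(W, x) \<in> loops n D"
      then have "walk n (W(c := x)) x ?D x"
        by (subst curl) (auto simp: loops_def walk_upd)
      then show "(W(c := x), x) \<in> loops n ?D"
        using W c by (auto simp: loops_def PiE_def extensional_def Pi_def)
    qed
    show "(\<lambda>(W, x). (restrict W (crossings D), x)) ` loops n ?D \<subseteq> loops n D"
    proof clarify
      fix W x assume W: "(W, x) \<in> loops n ?D"
      then have "walk n W x D x"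
        using curled by blast
      then show "(restrict W (crossings D), x) \<in> loops n D"
        using W by (auto simp: loops_def walk_restrict PiE_def Pi_def)
    qed
  qed
  then show ?thesis
    by (simp add: bij_betw_same_card)
qed

text \<open>The over-strand gives both new crossings the base colour \<open>x\<close>, and two
  reflections in the same colour cancel. So the new values of \<open>W\<close> carry no freedom and
  the rest of the walk is unchanged.\<close>

lemma card_loops_R2:
  assumes ab: "a \<noteq> b" "a \<notin> crossings (xs @ ys)" "b \<notin> crossings (xs @ ys)"
    and us: "us = [(Under, a, s), (Under, b, t)] \<or> us = [(Under, b, t), (Under, a, s)]"
  shows "card (loops n ([(Over, a, s), (Over, b, t)] @ xs @ us @ ys)) = card (loops n (xs @ ys))"
proof -
  let ?D = "[(Over, a, s), (Over, b, t)] @ xs @ us @ ys" and ?E = "xs @ ys"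
  have cr: "crossings ?D = insert a (insert b (crossings ?E))"
    using us by auto
  have walk_upd: "walk n (W(a := u, b := v)) x ?E y \<longleftrightarrow> walk n W x ?E y" for W u v x y
    using ab by (intro walk_cong) auto
  have walk_restrict: "walk n (restrict W (crossings ?E)) x ?E y \<longleftrightarrow> walk n W x ?E y" for W x y
    by (intro walk_cong) auto
  have bigon: "walk n W x ?D x \<longleftrightarrow> W a = x \<and> W b = x \<and> walk n W x ?E x"
    if x: "x \<in> {0..<n}" for W x
  proof -
    have "walk n W z us y \<longleftrightarrow> y = z" if "W a = x" "W b = x" "z \<in> {0..<n}" for y z
      using us that by (auto simp: mod_diff_right_eq)
    then show ?thesis
      using walk_range[OF _ x] by (auto simp: walk_append)
  qed
  have "bij_betw (\<lambda>(W, x). (W(a := x, b := x), x)) (loops n ?E) (loops n ?D)"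
  proof (rule bij_betw_byWitness[where f' = "\<lambda>(W, x). (restrict W (crossings ?E), x)"])
    show "\<forall>p\<in>loops n ?E. (\<lambda>(W, x). (restrict W (crossings ?E), x))
        ((\<lambda>(W, x). (W(a := x, b := x), x)) p) = p"
      using ab by (auto simp: loops_def PiE_def extensional_def fun_eq_iff)
    have "(restrict W (crossings ?E))(a := x, b := x) = W" if "(W, x) \<in> loops n ?D" for W x
    proof -
      have "W a = x \<and> W b = x" "W \<in> extensional (crossings ?D)"
        using bigon[of x W] that by (auto simp: loops_def PiE_def)
      then show ?thesis
        unfolding cr by (auto simp: extensional_def fun_eq_iff)
    qed
    then show "\<forall>p\<in>loops n ?D. (\<lambda>(W, x). (W(a := x, b := x), x))
        ((\<lambda>(W, x). (restrict W (crossings ?E), x)) p) = p"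
      by auto
    show "(\<lambda>(W, x). (W(a := x, b := x), x)) ` loops n ?E \<subseteq> loops n ?D"
    proof clarify
      fix W x assume W: "(W, x) \<in> loops n ?E"
      then have "walk n (W(a := x, b := x)) x ?D x"
        by (subst bigon, simp add: loops_def, subst walk_upd) (auto simp: loops_def ab)
      then show "(W(a := x, b := x), x) \<in> loops n ?D"
        using W ab unfolding loops_def cr by (auto simp: PiE_def extensional_def Pi_def)
    qed
    show "(\<lambda>(W, x). (restrict W (crossings ?E), x)) ` loops n ?D \<subseteq> loops n ?E"
    proof clarify
      fix W x assume W: "(W, x) \<in> loops n ?D"
      then have "walk n (restrict W (crossings ?E)) x ?E x"
        unfolding walk_restrict using bigon[of x W] by (auto simp: loops_def)
      moreover have "W \<in> crossings ?D \<rightarrow>\<^sub>E {0..<n}" "x \<in> {0..<n}"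
        using W by (auto simp: loops_def)
      ultimately show "(restrict W (crossings ?E), x) \<in> loops n ?E"
        unfolding loops_def cr by (auto simp: PiE_def Pi_def)
    qed
  qed
  then show ?thesis
    by (simp add: bij_betw_same_card)
qed


text \<open>
  Since only involutory quandles occur, neither the signs nor the position of the triangular face
  matter here: the middle strand just changes its colour under the top strand earlier or later.
\<close>

lemma loops_R3:
  assumes T: "T = [(Over, a, sa), (Over, b, sb)] \<or> T = [(Over, b, sb), (Over, a, sa)]"
    and M: "M = [(Under, a, sa), (Over, c, sc)] \<or> M = [(Over, c, sc), (Under, a, sa)]"
    and B: "B = [(Under, b, sb), (Under, c, sc)] \<or> B = [(Under, c, sc), (Under, b, sb)]"
    and PQ: "P = M \<and> Q = B \<or> P = B \<and> Q = M"
    and c: "c \<noteq> a" "c \<noteq> b" "c \<notin> crossings (xs @ ys @ zs)"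
    and W: "(W, x) \<in> loops n (T @ xs @ P @ ys @ Q @ zs)"
  shows "(W(c := (2 * W a - W c) mod n), x) \<in> loops n (rev T @ xs @ rev P @ ys @ rev Q @ zs)"
proof -
  define W' where "W' = W(c := (2 * W a - W c) mod n)"
  have x: "x \<in> {0..<n}" and ext: "W \<in> crossings (T @ xs @ P @ ys @ Q @ zs) \<rightarrow>\<^sub>E {0..<n}"
    and loop: "walk n W x (T @ xs @ P @ ys @ Q @ zs) x"
    using W by (auto simp: loops_def)
  have top: "walk n W' u (rev T) v" "W a = W b" if "walk n W u T v" for u v
    using that T c by (auto simp: W'_def)
  have same: "W a = W b"
    using top(2) loop unfolding walk_append by blast
  have Wc: "W c \<in> {0..<n}"
    using ext M PQ by (auto simp: PiE_def Pi_def)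
  have middle: "walk n W' u (rev M) v" if "walk n W u M v" "u \<in> {0..<n}" for u v
    using that M c Wc by (auto simp: W'_def mod_diff_right_eq)
  \<comment> \<open>Reflections conjugate one another: as \<open>W a = W b\<close>, reflecting in
    \<open>W b\<close> and then in \<open>W c\<close> is the same as reflecting in the new colour of
    \<open>c\<close> and then in \<open>W b\<close>; both are the translation by
    \<open>2 * W c - 2 * W b\<close>. The third identity treats the opposite order of
    \<open>B\<close>.\<close>
  have bottom: "walk n W' u (rev B) v" if "walk n W u B v" "u \<in> {0..<n}" for u v
  proof -
    have "(2 * W c - (2 * W b - u) mod n) mod n = (2 * W c - 2 * W b + u) mod n"
      by (simp add: mod_diff_right_eq algebra_simps)
    moreover have "(2 * W b - (2 * ((2 * W a - W c) mod n) - u) mod n) mod n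
        = (2 * W c - 2 * W b + u) mod n"
    proof -
      have "(2 * W b - (2 * ((2 * W a - W c) mod n) - u) mod n) mod n
          = (2 * W b + u - 2 * ((2 * W a - W c) mod n)) mod n"
        by (simp add: mod_diff_right_eq algebra_simps)
      also have "\<dots> = (2 * W b + u - 2 * (2 * W a - W c)) mod n"
        by (intro mod_diff_cong refl mod_mult_cong) auto
      finally show ?thesis
        by (simp add: same algebra_simps)
    qed
    moreover have "(2 * ((2 * W a - W c) mod n) - (2 * W b - u) mod n) mod n
        = (2 * W b - (2 * W c - u) mod n) mod n"
    proof -
      have "(2 * ((2 * W a - W c) mod n) - (2 * W b - u) mod n) mod n
          = (2 * (2 * W a - W c) - (2 * W b - u)) mod n"
        by (intro mod_diff_cong mod_mult_cong) auto
      also have "\<dots> = (2 * W b - (2 * W c - u)) mod n"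
        by (simp add: same algebra_simps)
      finally show ?thesis
        by (simp add: mod_diff_right_eq)
    qed
    ultimately show ?thesis
      using that B c by (auto simp: W'_def)
  qed
  have PQ': "walk n W' u (rev P) v" if "walk n W u P v" "u \<in> {0..<n}" for u v
    using PQ that middle bottom by blast
  have QP': "walk n W' u (rev Q) v" if "walk n W u Q v" "u \<in> {0..<n}" for u v
    using PQ that middle bottom by blast
  have rest: "walk n W' u E v \<longleftrightarrow> walk n W u E v" if "c \<notin> crossings E" for E u v
    using that by (intro walk_cong) (auto simp: W'_def)
  obtain u1 u2 u3 u4 u5 where u: "walk n W x T u1" "walk n W u1 xs u2" "walk n W u2 P u3"
    "walk n W u3 ys u4" "walk n W u4 Q u5" "walk n W u5 zs x"
    using loop unfolding walk_append by blast
  have r: "u2 \<in> {0..<n}" "u4 \<in> {0..<n}"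
    using u x walk_range by blast+
  have "walk n W' u1 xs u2" "walk n W' u3 ys u4" "walk n W' u5 zs x"
    using u(2,4,6) c(3) by (simp_all add: rest)
  then have "walk n W' x (rev T @ xs @ rev P @ ys @ rev Q @ zs) x"
    using top(1)[OF u(1)] PQ'[OF u(3) r(1)] QP'[OF u(5) r(2)] unfolding walk_append by blast
  moreover have "W' \<in> crossings (T @ xs @ P @ ys @ Q @ zs) \<rightarrow>\<^sub>E {0..<n}"
    using ext x M PQ by (auto simp: W'_def PiE_def Pi_def extensional_def)
  ultimately show ?thesis
    using x by (simp add: loops_def W'_def)
qed

text \<open>The two passages of \<open>c\<close> lie in \<open>M\<close> and \<open>B\<close>, so
  distinctness separates \<open>c\<close> from \<open>a\<close> and \<open>b\<close> and keeps it
  out of the remaining code. Recolouring \<open>c\<close> is therefore local, and being an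
  involution it gives mutually inverse maps when \<open>loops_R3\<close> is applied to the triangle
  and to its reversal.\<close>

lemma card_loops_R3:
  assumes tri: "triangle T M B"
    and PQ: "P = M \<and> Q = B \<or> P = B \<and> Q = M"
    and dist: "distinct (map (\<lambda>(l, c, s). (l, c)) (T @ xs @ P @ ys @ Q @ zs))"
    and both: "\<forall>c s. (Over, c, s) \<in> set (T @ xs @ P @ ys @ Q @ zs) \<longleftrightarrow>
      (Under, c, s) \<in> set (T @ xs @ P @ ys @ Q @ zs)"
  shows "card (loops n (rev T @ xs @ rev P @ ys @ rev Q @ zs)) = card (loops n (T @ xs @ P @ ys @ Q @ zs))"
proof -
  let ?D = "T @ xs @ P @ ys @ Q @ zs" and ?E = "rev T @ xs @ rev P @ ys @ rev Q @ zs"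
  obtain a b c sa sb sc e1 e2 e3 where
    "T = (if e1 then id else rev) [(Over, a, sa), (Over, b, sb)]"
    "M = (if e2 then id else rev) [(Under, a, sa), (Over, c, sc)]"
    "B = (if e3 then id else rev) [(Under, b, sb), (Under, c, sc)]"
    using tri unfolding triangle_def by (elim exE conjE) (rule that)
  then have T: "T = [(Over, a, sa), (Over, b, sb)] \<or> T = [(Over, b, sb), (Over, a, sa)]"
    and M: "M = [(Under, a, sa), (Over, c, sc)] \<or> M = [(Over, c, sc), (Under, a, sa)]"
    and B: "B = [(Under, b, sb), (Under, c, sc)] \<or> B = [(Under, c, sc), (Under, b, sb)]"
    by simp_all
  define k where "k = (\<lambda>(l :: level, c :: nat, s :: bool). (l, c))"
  let ?R = "xs @ ys @ zs"
  have sep: "set a \<inter> set c = {}" "set a \<inter> set e = {}" "set c \<inter> set (b @ d @ f) = {}"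
    "set e \<inter> set (b @ d @ f) = {}"
    if "distinct (a @ b @ c @ d @ e @ f)" for a b c d e f :: "(level \<times> nat) list"
    using that by auto
  have "distinct (map k T @ map k xs @ map k P @ map k ys @ map k Q @ map k zs)"
    using dist by (simp only: k_def map_append)
  then have "k ` set T \<inter> k ` set P = {}" "k ` set T \<inter> k ` set Q = {}"
    "k ` set P \<inter> k ` set ?R = {}" "k ` set Q \<inter> k ` set ?R = {}"
    unfolding set_map[symmetric] map_append by (rule sep)+
  with PQ have disj: "k ` set T \<inter> k ` set M = {}" "k ` set T \<inter> k ` set B = {}"
    "k ` set M \<inter> k ` set ?R = {}" "k ` set B \<inter> k ` set ?R = {}"
    by metis+
  have ab: "(Over, a) \<in> k ` set T" "(Over, b) \<in> k ` set T"
    using T by (elim disjE; simp add: k_def)+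
  have o: "(Over, c) \<in> k ` set M"
    using M by (elim disjE; simp add: k_def)
  have u: "(Under, c) \<in> k ` set B"
    using B by (elim disjE; simp add: k_def)
  have c: "c \<noteq> a" "c \<noteq> b"
    using disj(1) ab o by (metis disjoint_iff)+
  have k: "(l, c) \<notin> k ` set ?R" for l
    using disj(3,4) o u by (cases l) (metis disjoint_iff)+
  have c': "c \<notin> crossings ?R"
  proof
    assume "c \<in> crossings ?R"
    then obtain l s where "(l, c, s) \<in> set ?R"
      by (auto simp: crossings_def simp del: set_append)
    then have "(l, c) \<in> k ` set ?R"
      by (force simp: k_def simp del: set_append)
    then show False
      using k by blast
  qed
  define f where "f = (\<lambda>(W, x). (W(c := (2 * W a - W c) mod n), x :: int))"
  have invol: "f (f p) = p" if "p \<in> loops n ?D \<union> loops n ?E" for p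
  proof -
    obtain W x where p: "p = (W, x)"
      by (cases p)
    have "c \<in> crossings M"
      using M by auto
    then have "c \<in> crossings ?D" "c \<in> crossings ?E"
      using PQ by auto
    then have "W c \<in> {0..<n}"
      using that p unfolding loops_def PiE_def Pi_def by blast
    then show ?thesis
      using c by (auto simp: p f_def mod_diff_right_eq)
  qed
  have T': "rev T = [(Over, a, sa), (Over, b, sb)] \<or> rev T = [(Over, b, sb), (Over, a, sa)]"
    using T by (elim disjE) simp_all
  have M': "rev M = [(Under, a, sa), (Over, c, sc)] \<or> rev M = [(Over, c, sc), (Under, a, sa)]"
    using M by (elim disjE) simp_all
  have B': "rev B = [(Under, b, sb), (Under, c, sc)] \<or> rev B = [(Under, c, sc), (Under, b, sb)]"
    using B by (elim disjE) simp_all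
  have PQ': "rev P = rev M \<and> rev Q = rev B \<or> rev P = rev B \<and> rev Q = rev M"
    using PQ by blast
  have "f p \<in> loops n ?E" if "p \<in> loops n ?D" for p
    using loops_R3[OF T M B PQ c c', of "fst p" "snd p" n] that by (simp add: f_def case_prod_unfold)
  moreover have "f p \<in> loops n ?D" if "p \<in> loops n ?E" for p
    using loops_R3[OF T' M' B' PQ' c c', of "fst p" "snd p" n] that
    by (simp add: f_def case_prod_unfold)
  ultimately have "bij_betw f (loops n ?E) (loops n ?D)"
    using invol by (intro bij_betw_byWitness[where f' = f]) blast+
  then show ?thesis
    by (rule bij_betw_same_card)
qed

lemma card_loops_move:
  assumes "move D D'" "knot_diagram D" "knot_diagram D'"
  shows "card (loops n D') = card (loops n D)"
  using assms
proof (induction rule: move.induct)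
  case (base_point xs ys)
  show ?case
    using loops_base_point_le[of n xs ys] loops_base_point_le[of n ys xs] by simp
next
  case (relabel f D)
  then show ?case
    by (simp add: card_loops_relabel)
next
  case (reverse D)
  show ?case
    by (simp add: loops_rev)
next
  case (R1 c D l s)
  then show ?case
    using card_loops_R1 by simp
next
  case (R2 a b xs ys us s)
  show ?case
    using R2(1-4) by (rule card_loops_R2)
next
  case (R3_top_middle_bottom T M B xs ys zs)
  show ?case
    using R3_top_middle_bottom(2) unfolding knot_diagram_def
    by (intro card_loops_R3[OF R3_top_middle_bottom(1)]) blast+
next
  case (R3_top_bottom_middle T M B xs ys zs)
  show ?case
    using R3_top_bottom_middle(2) unfolding knot_diagram_def
    by (intro card_loops_R3[OF R3_top_bottom_middle(1)]) blast+
qed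

lemma card_loops_knot:
  assumes "D' \<in> knot D"
  shows "card (loops n D') = card (loops n D)"
proof -
  have "equivclp diagram_move D D'"
    using assms by (simp add: knot_def)
  then show ?thesis
    by (induction rule: equivclp_induct) (metis diagram_move_def card_loops_move)+
qed

section \<open>From loops back to colourings of arcs\<close>

definition fox_colourings :: "int \<Rightarrow> gauss \<Rightarrow> (nat \<Rightarrow> int) set" where
  "fox_colourings n D =
     {X \<in> crossings D \<rightarrow>\<^sub>E {0..<n}.
        \<forall>c \<in> crossings D. X c = (2 * X (over_arc D c) - X (under_in D c)) mod n}"

lemma colourings_eq_fox:
  assumes n: "n \<ge> 1" and m: "n dvd m + 1"
  shows "coprime n m" "colourings n m D = fox_colourings n D"
proof -
  have "[m = - 1] (mod n)"
    using m by (simp add: cong_iff_dvd_diff)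
  moreover have "coprime n (- 1)"
    by simp
  ultimately show cop: "coprime n m"
    by (metis cong_imp_coprime cong_sym coprime_commute)
  have "[m * modular_inverse n m = 1] (mod n)"
    using cop by (intro cong_modular_inverse1) (simp add: coprime_commute)
  moreover have "[m * modular_inverse n m = - 1 * modular_inverse n m] (mod n)"
    using \<open>[m = - 1] (mod n)\<close> by (rule cong_scalar_right)
  ultimately have "[- 1 * modular_inverse n m = 1] (mod n)"
    by (metis cong_sym cong_trans)
  from cong_scalar_left[OF this, of "- 1"] have inv: "[modular_inverse n m = - 1] (mod n)"
    by simp
  have op: "(k * a + (1 - k) * b) mod n = (2 * b - a) mod n" if "[k = - 1] (mod n)" for k a b
  proof -
    have "[k * a + (1 - k) * b = - 1 * a + (1 - - 1) * b] (mod n)"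
      using that by (intro cong_add cong_mult cong_diff cong_refl)
    then show ?thesis
      by (simp add: cong_def)
  qed
  show "colourings n m D = fox_colourings n D"
    unfolding colourings_def fox_colourings_def quandle_op_def quandle_op'_def
    by (simp add: op[OF inv] op[OF \<open>[m = - 1] (mod n)\<close>])
qed

text \<open>The conditions of \<open>knot_diagram\<close> apart from the count of faces. They make
  \<open>position\<close> well defined, which the executable check of the faces itself relies
  on.\<close>

definition valid_code :: "gauss \<Rightarrow> bool" where
  "valid_code D \<longleftrightarrow> D \<noteq> [] \<and> distinct (map (\<lambda>(l, c, s). (l, c)) D) \<and>
     (\<forall>c s. (Over, c, s) \<in> set D \<longleftrightarrow> (Under, c, s) \<in> set D)"

lemma knot_diagram_valid: "knot_diagram D \<Longrightarrow> valid_code D"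
  by (simp add: knot_diagram_def valid_code_def)

lemma position_eqI:
  assumes D: "distinct (map (\<lambda>(l, c, s). (l, c)) D)" and i: "i < length D" "D ! i = (l, c, s)"
  shows "position D l c = i"
  unfolding position_def
proof (rule the_equality)
  fix j assume "j < length D \<and> (\<exists>s. D ! j = (l, c, s))"
  then have "j < length D" "map (\<lambda>(l, c, s). (l, c)) D ! j = map (\<lambda>(l, c, s). (l, c)) D ! i"
    using i by auto
  then show "j = i"
    using D i by (simp only: nth_eq_iff_index_eq length_map)
qed (use i in auto)

lemma valid_code_occurs:
  assumes "valid_code D" "c \<in> crossings D"
  obtains i s where "i < length D" "D ! i = (l, c, s)" "position D l c = i"
proof -
  obtain l' s where "(l', c, s) \<in> set D"
    using assms(2) by (auto simp: crossings_def)
  then have "(l, c, s) \<in> set D"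
    using assms(1) unfolding valid_code_def by (cases l; cases l') auto
  then obtain i where "i < length D" "D ! i = (l, c, s)"
    by (auto simp: in_set_conv_nth)
  then show thesis
    using that position_eqI assms(1) unfolding valid_code_def by blast
qed

text \<open>Rotating once more moves passage \<open>i\<close> to the end of the list, where it
  changes the last under-passage only if it is one itself.\<close>

lemma arc_into_Suc:
  assumes "i < length D" "D ! i = (l, c, s)" "(Under, c', s') \<in> set D"
  shows "arc_into D (Suc i) = (if l = Under then c else arc_into D i)"
proof -
  have "D \<noteq> []"
    using assms(1) by auto
  then have "hd (rotate i D) = (l, c, s)" "rotate i D \<noteq> []"
    using assms(1,2) hd_rotate_conv_nth[of D i] by simp_all
  then obtain E where E: "rotate i D = (l, c, s) # E"
    by (metis list.collapse)
  then have rot: "rotate (Suc i) D = E @ [(l, c, s)]"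
    by simp
  show ?thesis
  proof (cases "l = Under")
    case True
    then show ?thesis
      by (simp add: arc_into_def rot del: rotate_Suc)
  next
    case False
    have "filter (\<lambda>p. fst p = Under) (rotate (Suc i) D) = filter (\<lambda>p. fst p = Under) (rotate i D)"
      unfolding rot E using False by simp
    then show ?thesis
      using False by (simp add: arc_into_def del: rotate_Suc)
  qed
qed

lemma arc_into_crossing:
  assumes "valid_code D"
  shows "arc_into D i \<in> crossings D"
proof -
  obtain l c s where "(l, c, s) \<in> set D"
    using assms unfolding valid_code_def by (cases D) auto
  then have "(Under, c, s) \<in> set D"
    using assms unfolding valid_code_def by (cases l) auto
  then have "filter (\<lambda>p. fst p = Under) (rotate i D) \<noteq> []"
    by (force simp: filter_empty_conv)
  then have "last (filter (\<lambda>p. fst p = Under) (rotate i D)) \<in> set D"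
    using last_in_set by fastforce
  then show ?thesis
    unfolding arc_into_def crossings_def by (simp add: case_prod_unfold)
qed

lemma arc_into_length: "arc_into D (length D) = arc_into D 0"
  by (simp add: arc_into_def rotate_id)

text \<open>\<open>col\<close> keeps the colours of the over-arcs and of the arc at the base point.
  It loses nothing, because a walk around the code is determined by these and visits each arc right
  after the under-passage that names it.\<close>

lemma card_fox_colourings:
  assumes D: "valid_code D"
  shows "card (fox_colourings n D) = card (loops n D)"
proof -
  define col where "col = (\<lambda>X. (restrict (\<lambda>c. X (over_arc D c)) (crossings D), X (arc_into D 0)) :: (nat \<Rightarrow> int) \<times> int)"
  have in_cr: "c \<in> crossings D" if "i < length D" "D ! i = (l, c, s)" for i l c s
    using that unfolding crossings_def by (metis (mono_tags, lifting) case_prod_conv image_iff nth_mem)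
  obtain c0 s0 where c0: "(Under, c0, s0) \<in> set D"
  proof -
    obtain l c s where "(l, c, s) \<in> set D"
      using D unfolding valid_code_def by (cases D) auto
    then have "(Under, c, s) \<in> set D"
      using D unfolding valid_code_def by (cases l) auto
    then show thesis
      using that by blast
  qed
  obtain i0 where i0: "i0 < length D" "D ! i0 = (Under, c0, s0)"
    using c0 by (auto simp: in_set_conv_nth)
  have arc_Suc: "arc_into D (Suc i) = (if l = Under then c else arc_into D i)"
    if "i < length D" "D ! i = (l, c, s)" for i l c s
    using arc_into_Suc that c0 by blast
  have pos: "position D l c = i" if "i < length D" "D ! i = (l, c, s)" for i l c s
    using position_eqI that D unfolding valid_code_def by blast
  have under: "under_in D c = arc_into D i" if "i < length D" "D ! i = (Under, c, s)" for i c s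
    using pos[OF that] by (simp add: under_in_def)
  have over: "over_arc D c = arc_into D i" if "i < length D" "D ! i = (Over, c, s)" for i c s
    using pos[OF that] by (simp add: over_arc_def)
  have arc_in: "arc_into D i \<in> crossings D" for i
    using D by (rule arc_into_crossing)
  have walk_col: "walk n (fst (col X)) (X (arc_into D 0)) (take i D) (X (arc_into D i))"
    if X: "X \<in> fox_colourings n D" and "i \<le> length D" for X i
    using \<open>i \<le> length D\<close>
  proof (induction i)
    case (Suc i)
    then have i: "i < length D" and IH: "walk n (fst (col X)) (X (arc_into D 0)) (take i D) (X (arc_into D i))"
      by auto
    obtain l c s where lcs: "D ! i = (l, c, s)"
      by (cases "D ! i")
    have "walk n (fst (col X)) (X (arc_into D i)) [(l, c, s)] (X (arc_into D (Suc i)))"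
      using X arc_Suc[OF i lcs] under[OF i] over[OF i] in_cr[OF i lcs] lcs
      by (cases l) (auto simp: col_def fox_colourings_def)
    then show ?case
      using IH i lcs by (auto simp: take_Suc_conv_app_nth walk_append)
  qed auto
  have "inj_on col (fox_colourings n D)"
  proof (rule inj_onI)
    fix X Y assume XY: "X \<in> fox_colourings n D" "Y \<in> fox_colourings n D" "col X = col Y"
    have "X c = Y c" if c: "c \<in> crossings D" for c
    proof -
      obtain i s where i: "i < length D" "D ! i = (Under, c, s)"
        using valid_code_occurs[OF D c] by metis
      have "walk n (fst (col X)) (X (arc_into D 0)) (take (Suc i) D) (X (arc_into D (Suc i)))"
        "walk n (fst (col X)) (X (arc_into D 0)) (take (Suc i) D) (Y (arc_into D (Suc i)))"
        using walk_col[OF XY(1), of "Suc i"] walk_col[OF XY(2), of "Suc i"] XY(3) i(1)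
        by (simp_all add: col_def)
      then have "X (arc_into D (Suc i)) = Y (arc_into D (Suc i))"
        by (rule walk_unique)
      then show ?thesis
        by (simp add: arc_Suc[OF i])
    qed
    then show "X = Y"
      using XY(1,2) unfolding fox_colourings_def by (blast intro: PiE_ext)
  qed
  moreover have "col ` fox_colourings n D = loops n D"
  proof (intro equalityI subsetI)
    fix p assume "p \<in> col ` fox_colourings n D"
    then obtain X where X: "X \<in> fox_colourings n D" "p = col X"
      by blast
    have ran: "X c \<in> {0..<n}" if "c \<in> crossings D" for c
      using X(1) that unfolding fox_colourings_def by blast
    have over_in: "over_arc D c \<in> crossings D" for c
      by (simp add: over_arc_def arc_in)
    have "walk n (fst (col X)) (X (arc_into D 0)) D (X (arc_into D 0))"
      using walk_col[OF X(1), of "length D"] by (simp add: arc_into_length)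
    then show "p \<in> loops n D"
      using ran over_in arc_in unfolding X(2) loops_def col_def by (simp add: PiE_def Pi_def)
  next
    fix p assume "p \<in> loops n D"
    then obtain W x where p: "p = (W, x)" and W: "W \<in> crossings D \<rightarrow>\<^sub>E {0..<n}"
      and x: "x \<in> {0..<n}" and loop: "walk n W x D x"
      by (auto simp: loops_def)
    \<comment> \<open>\<open>v i\<close> is the colour that the walk carries just before passage
      \<open>i\<close>.\<close>
    define v where "v = (\<lambda>i. SOME y. walk n W x (take i D) y \<and> walk n W y (drop i D) x)"
    have v: "walk n W x (take i D) (v i)" "walk n W (v i) (drop i D) x" for i
    proof -
      have "\<exists>y. walk n W x (take i D) y \<and> walk n W y (drop i D) x"
        using loop walk_append[of n W x "take i D" "drop i D" x] by simp
      from someI_ex[OF this] show "walk n W x (take i D) (v i)" "walk n W (v i) (drop i D) x"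
        by (simp_all add: v_def)
    qed
    have v0: "v 0 = x" and vl: "v (length D) = x"
      using v(1)[of 0] v(2)[of "length D"] by auto
    have v_ran: "v i \<in> {0..<n}" for i
      using walk_range[OF v(1) x] .
    have step: "walk n W (v i) [D ! i] (v (Suc i))" if "i < length D" for i
      using v(1)[of "Suc i"] v(1)[of i] walk_unique that
      by (auto simp: take_Suc_conv_app_nth walk_append dest: walk_unique)
    define X where "X = restrict (\<lambda>c. v (Suc (position D Under c))) (crossings D)"
    have X_Under: "X (arc_into D (Suc i)) = v (Suc i)" if "i < length D" "D ! i = (Under, c, s)" for i c s
      using that by (simp add: arc_Suc[OF that] X_def pos[OF that] in_cr[OF that])
    have X_Suc: "X (arc_into D (Suc i)) = v (Suc i)"
      if i: "i < length D" and X_i: "X (arc_into D i) = v i" for i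
    proof -
      obtain l c s where lcs: "D ! i = (l, c, s)"
        by (cases "D ! i")
      show ?thesis
      proof (cases l)
        case Over
        then show ?thesis
          using arc_Suc[OF i lcs] step[OF i] lcs X_i by simp
      next
        case Under
        then show ?thesis
          using X_Under i lcs by blast
      qed
    qed
    \<comment> \<open>The first passages may lie on an arc that begins before the base point, so an
      induction from 0 has no start. It starts after the under-passage \<open>i0\<close> instead,
      runs to the end of the code and wraps around with \<open>v (length D) = x\<close>; only then
      is the value at 0 known.\<close>
    have X_after: "X (arc_into D (Suc i0 + k)) = v (Suc i0 + k)" if "Suc i0 + k \<le> length D" for k
      using that
    proof (induction k)
      case 0
      then show ?case
        using X_Under i0 by simp
    next
      case (Suc k)
      then show ?case
        using X_Suc[of "Suc i0 + k"] by simp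
    qed
    have len: "Suc i0 + (length D - Suc i0) = length D"
      using i0(1) by simp
    have "X (arc_into D (length D)) = v (length D)"
      using X_after[of "length D - Suc i0"] unfolding len by simp
    then have X0: "X (arc_into D 0) = x"
      by (simp add: arc_into_length vl)
    have X_arc: "X (arc_into D i) = v i" if "i \<le> length D" for i
      using that by (induction i) (use X0 v0 X_Suc in auto)
    have X_over: "X (over_arc D c) = W c" if c: "c \<in> crossings D" for c
    proof -
      obtain i s where i: "i < length D" "D ! i = (Over, c, s)"
        using valid_code_occurs[OF D c] by metis
      then show ?thesis
        using over[OF i] X_arc[of i] step[OF i(1)] by simp
    qed
    have "X \<in> fox_colourings n D"
      unfolding fox_colourings_def
    proof (intro CollectI conjI ballI)
      show "X \<in> crossings D \<rightarrow>\<^sub>E {0..<n}"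
        using v_ran by (auto simp: X_def PiE_def Pi_def)
      fix c assume c: "c \<in> crossings D"
      obtain i s where i: "i < length D" "D ! i = (Under, c, s)"
        using valid_code_occurs[OF D c] by metis
      have "X c = v (Suc i)"
        using c by (simp add: X_def pos[OF i])
      then show "X c = (2 * X (over_arc D c) - X (under_in D c)) mod n"
        using step[OF i(1)] i X_over[OF c] under[OF i] X_arc[of i] by simp
    qed
    moreover have "col X = p"
      using W X_over X0 unfolding p col_def by (auto simp: PiE_def extensional_def fun_eq_iff)
    ultimately show "p \<in> col ` fox_colourings n D"
      by blast
  qed
  ultimately show ?thesis
    by (metis card_image)
qed

section \<open>Row reduction over the Laurent polynomials\<close>

lemma mpow_add: "mpow (a + b) = mpow a * mpow b"
  by (simp add: mpow_def mult_single)

lemma mpow_0 [simp]: "mpow 0 = 1"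
  by (simp add: mpow_def)

lemma mpow_1_power: "mpow 1 ^ k = mpow (int k)"
proof (induction k)
  case (Suc k)
  then show ?case
    using mpow_add[of 1 "int k"] by (simp add: add.commute)
qed simp

text \<open>The units of the Laurent polynomials, which are also the factors that a row can collect
  by operations of kind (a).\<close>

definition laurent_unit :: "laurent \<Rightarrow> bool" where
  "laurent_unit u \<longleftrightarrow> (\<exists>s k. s \<in> {1, -1} \<and> u = s * mpow k)"

lemma laurent_unit_mpow: "laurent_unit (mpow k)"
  unfolding laurent_unit_def by (metis insertI1 mult_1)

lemma laurent_unit_1: "laurent_unit 1"
  using laurent_unit_mpow[of 0] by simp

lemma laurent_unit_uminus_1: "laurent_unit (- 1)"
  unfolding laurent_unit_def by (metis insertCI mpow_0 mult.right_neutral)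

lemma laurent_unit_mult:
  assumes "laurent_unit u" "laurent_unit v"
  shows "laurent_unit (u * v)"
proof -
  obtain s k t l where "s \<in> {1, -1}" "u = s * mpow k" "t \<in> {1, -1}" "v = t * mpow l"
    using assms unfolding laurent_unit_def by blast
  then have "s * t \<in> {1, -1}" "u * v = (s * t) * mpow (k + l)"
    by (auto simp: mpow_add)
  then show ?thesis
    unfolding laurent_unit_def by blast
qed

lemma laurent_unit_inverse:
  assumes "laurent_unit u"
  obtains v where "laurent_unit v" "v * u = 1"
proof -
  obtain s k where s: "s \<in> {1, -1}" "u = s * mpow k"
    using assms unfolding laurent_unit_def by blast
  then have "(s * mpow (- k)) * u = 1"
    using mpow_add[of "- k" k] by auto
  moreover have "laurent_unit (s * mpow (- k))"
    using s unfolding laurent_unit_def by blast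
  ultimately show thesis
    using that by blast
qed

lemma laurent_unit_prod:
  "(\<And>i. i \<in> I \<Longrightarrow> laurent_unit (f i)) \<Longrightarrow> laurent_unit (prod f I)"
  by (induction I rule: infinite_finite_induct) (auto intro: laurent_unit_1 laurent_unit_mult)

lemma matrix_equivalent_refl: "matrix_equivalent A A"
  by (simp add: matrix_equivalent_def)

lemma matrix_equivalent_trans:
  "matrix_equivalent A B \<Longrightarrow> matrix_equivalent B C \<Longrightarrow> matrix_equivalent A C"
  by (simp add: matrix_equivalent_def)

lemma multrow_multrow:
  fixes A :: "'a :: comm_ring_1 mat"
  shows "multrow k u (multrow k v A) = multrow k (u * v) A"
  by (rule eq_matI) (auto simp: mult.assoc)

lemma matrix_equivalent_multrow:
  assumes u: "laurent_unit u" and k: "k < dim_row A"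
  shows "matrix_equivalent A (multrow k u A)"
proof -
  have step: "matrix_equivalent B (multrow k v B)"
    if "v \<in> {mpow 1, mpow (-1), -1}" "k < dim_row B" for v and B :: "laurent mat"
    unfolding matrix_equivalent_def by (intro r_into_rtranclp matrix_step.intros(1) that)
  have mult: "matrix_equivalent A (multrow k (v * w) A)"
    if "v \<in> {mpow 1, mpow (-1), -1}" "matrix_equivalent A (multrow k w A)" for v w
    using matrix_equivalent_trans[OF that(2) step[OF that(1)]] k by (simp add: multrow_multrow)
  have one: "multrow k 1 A = A"
    by (rule eq_matI) auto
  have pos: "matrix_equivalent A (multrow k (mpow (int j)) A)" for j
  proof (induction j)
    case (Suc j)
    then show ?case
      using mult[of "mpow 1" "mpow (int j)"] mpow_add[of 1 "int j"] by simp
  qed (simp add: one matrix_equivalent_refl)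
  have neg: "matrix_equivalent A (multrow k (mpow (- int j)) A)" for j
  proof (induction j)
    case (Suc j)
    then show ?case
      using mult[of "mpow (-1)" "mpow (- int j)"] mpow_add[of "-1" "- int j"] by simp
  qed (simp add: one matrix_equivalent_refl)
  have mpow: "matrix_equivalent A (multrow k (mpow j) A)" for j
    using pos neg by (cases j rule: int_cases2) auto
  obtain s j where s: "s \<in> {1, -1}" "u = s * mpow j"
    using u unfolding laurent_unit_def by blast
  then show ?thesis
    using mpow[of j] mult[of "- 1" "mpow j"] by auto
qed

text \<open>A single step adds a row with coefficient 1. The coefficients that can be reached are
  closed under sums and under multiplication by a unit: scale row \<open>l\<close> by the unit, add,
  and scale back. Horner's scheme then yields every integer polynomial in \<open>m\<close>.\<close>

lemma matrix_equivalent_addrow: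
  assumes "k < dim_row A" "l < dim_row A" "k \<noteq> l"
  shows "matrix_equivalent A (addrow (horner_sum of_int (mpow 1) cs) k l A)"
proof -
  \<comment> \<open>The quantifier over all matrices lets the steps be chained, since each acts on a
    matrix changed by the previous ones.\<close>
  define ok where "ok p \<longleftrightarrow> (\<forall>A. k < dim_row A \<longrightarrow> l < dim_row A \<longrightarrow> matrix_equivalent A (addrow p k l A))" for p
  have ok0: "ok 0"
  proof -
    have "addrow 0 k l A = A" for A :: "laurent mat"
      by (rule eq_matI) auto
    then show ?thesis
      by (simp add: ok_def matrix_equivalent_refl)
  qed
  have ok1: "ok 1"
    unfolding ok_def matrix_equivalent_def using assms(3) by (blast intro: matrix_step.intros(2))
  have ok_add: "ok (p + q)" if "ok p" "ok q" for p q
  proof -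
    have "addrow q k l (addrow p k l A) = addrow (p + q) k l A" if "l < dim_row A" for A :: "laurent mat"
      using assms(3) that by (intro eq_matI) (auto simp: algebra_simps)
    moreover have "matrix_equivalent A (addrow q k l (addrow p k l A))"
      if "k < dim_row A" "l < dim_row A" for A :: "laurent mat"
    proof (rule matrix_equivalent_trans)
      show "matrix_equivalent A (addrow p k l A)"
        using \<open>ok p\<close> that by (simp add: ok_def)
      show "matrix_equivalent (addrow p k l A) (addrow q k l (addrow p k l A))"
        using \<open>ok q\<close> that unfolding ok_def by simp
    qed
    ultimately show ?thesis
      by (simp add: ok_def)
  qed
  have ok_mult: "ok (p * u)" if p: "ok p" and u: "laurent_unit u" for p u
    unfolding ok_def
  proof (intro allI impI)
    fix A :: "laurent mat" assume kl: "k < dim_row A" "l < dim_row A"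
    obtain v where v: "laurent_unit v" "v * u = 1"
      using laurent_unit_inverse[OF u] .
    have "matrix_equivalent A (multrow l u A)"
      using u kl by (intro matrix_equivalent_multrow)
    moreover have "matrix_equivalent (multrow l u A) (addrow p k l (multrow l u A))"
      using p kl by (simp add: ok_def)
    moreover have "matrix_equivalent (addrow p k l (multrow l u A))
        (multrow l v (addrow p k l (multrow l u A)))"
      using v kl by (intro matrix_equivalent_multrow) auto
    moreover have "multrow l v (addrow p k l (multrow l u A)) = addrow (p * u) k l A"
      using assms(3) kl v(2) by (intro eq_matI) (auto simp: mult.assoc[symmetric])
    ultimately show "matrix_equivalent A (addrow (p * u) k l A)"
      by (auto simp: matrix_equivalent_def)
  qed
  have ok_minus: "ok (- p)" if "ok p" for p
    using ok_mult[OF that laurent_unit_uminus_1] by simp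
  have ok_nat: "ok (of_nat c)" for c
    by (induction c) (auto intro: ok0 ok1 ok_add)
  have ok_int: "ok (of_int c)" for c
    by (cases c rule: int_cases2) (auto intro: ok_nat ok_minus)
  have "ok (horner_sum of_int (mpow 1) cs)"
  proof (induction cs)
    case (Cons c cs)
    then show ?case
      using ok_add[OF ok_int ok_mult[OF Cons laurent_unit_mpow]] by (simp add: mult.commute)
  qed (simp add: ok0)
  then show ?thesis
    using assms by (simp add: ok_def)
qed

text \<open>
  The last row is never added to another one, so that deleting the last row and column commutes
  with the reduction.
\<close>

definition reduces :: "nat \<Rightarrow> laurent mat \<Rightarrow> laurent mat \<Rightarrow> bool" where
  "reduces N A B \<longleftrightarrow> A \<in> carrier_mat N N \<and> B \<in> carrier_mat N N \<and> matrix_equivalent A B \<and>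
     (\<exists>u. laurent_unit u \<and> det (mat_delete B (N - 1) (N - 1)) = u * det (mat_delete A (N - 1) (N - 1)))"

lemma reduces_refl: "A \<in> carrier_mat N N \<Longrightarrow> reduces N A A"
  unfolding reduces_def using matrix_equivalent_refl laurent_unit_1 by (metis mult_1)

lemma reduces_trans:
  assumes "reduces N A B" "reduces N B C"
  shows "reduces N A C"
proof -
  obtain u v where "laurent_unit u" "laurent_unit v"
    "det (mat_delete B (N - 1) (N - 1)) = u * det (mat_delete A (N - 1) (N - 1))"
    "det (mat_delete C (N - 1) (N - 1)) = v * det (mat_delete B (N - 1) (N - 1))"
    using assms unfolding reduces_def by blast
  then have "laurent_unit (v * u)"
    "det (mat_delete C (N - 1) (N - 1)) = (v * u) * det (mat_delete A (N - 1) (N - 1))"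
    by (simp_all add: laurent_unit_mult mult.assoc)
  then show ?thesis
    using assms matrix_equivalent_trans unfolding reduces_def by blast
qed

lemma mat_delete_last:
  assumes "A \<in> carrier_mat N N"
  shows "mat_delete A (N - 1) (N - 1) = mat (N - 1) (N - 1) (\<lambda>ij. A $$ ij)"
  using assms by (intro eq_matI) (auto simp: mat_delete_def)

lemma reduces_multrow:
  assumes A: "A \<in> carrier_mat N N" and u: "laurent_unit u" and k: "k < N"
  shows "reduces N A (multrow k u A)"
proof -
  let ?del = "\<lambda>A. mat_delete A (N - 1) (N - 1)"
  have del: "?del A \<in> carrier_mat (N - 1) (N - 1)"
    unfolding mat_delete_last[OF A] by simp
  have "\<exists>v. laurent_unit v \<and> det (?del (multrow k u A)) = v * det (?del A)"
  proof (cases "k = N - 1")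
    case True
    have B: "multrow k u A \<in> carrier_mat N N"
      using A by simp
    have "?del (multrow k u A) = ?del A"
      unfolding mat_delete_last[OF A] mat_delete_last[OF B] using A True by (intro eq_matI) auto
    then show ?thesis
      using laurent_unit_1 by (metis mult_1)
  next
    case False
    then have k': "k < N - 1"
      using k by simp
    have B: "multrow k u A \<in> carrier_mat N N"
      using A by simp
    have "?del (multrow k u A) = multrow k u (?del A)"
      unfolding mat_delete_last[OF A] mat_delete_last[OF B] using A by (intro eq_matI) auto
    then show ?thesis
      using u det_multrow[OF k' del] by metis
  qed
  then show ?thesis
    using A u k matrix_equivalent_multrow[of u k A] by (auto simp: reduces_def)
qed

lemma reduces_addrow:
  assumes A: "A \<in> carrier_mat N N" and kl: "k < N" "l < N - 1" "k \<noteq> l"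
  shows "reduces N A (addrow (horner_sum of_int (mpow 1) cs) k l A)"
proof -
  let ?del = "\<lambda>A. mat_delete A (N - 1) (N - 1)" and ?p = "horner_sum of_int (mpow 1) cs :: laurent"
  have del: "?del A \<in> carrier_mat (N - 1) (N - 1)"
    unfolding mat_delete_last[OF A] by simp
  have "det (?del (addrow ?p k l A)) = det (?del A)"
  proof (cases "k = N - 1")
    case True
    have B: "addrow ?p k l A \<in> carrier_mat N N"
      using A by simp
    have "?del (addrow ?p k l A) = ?del A"
      unfolding mat_delete_last[OF A] mat_delete_last[OF B] using A True by (intro eq_matI) auto
    then show ?thesis
      by simp
  next
    case False
    have B: "addrow ?p k l A \<in> carrier_mat N N"
      using A by simp
    have "?del (addrow ?p k l A) = addrow ?p k l (?del A)"
      unfolding mat_delete_last[OF A] mat_delete_last[OF B] using A kl by (intro eq_matI) auto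
    then show ?thesis
      using det_addrow[OF kl(2,3) del] by simp
  qed
  then show ?thesis
    using A kl matrix_equivalent_addrow[of k A l cs] laurent_unit_1
    by (auto simp: reduces_def intro!: exI[of _ 1])
qed

lemma reduces_scale:
  assumes A: "A \<in> carrier_mat N N" and u: "\<And>i. i < N \<Longrightarrow> laurent_unit (u i)"
  shows "reduces N A (mat N N (\<lambda>(i, j). u i * A $$ (i, j)))"
proof -
  have "reduces N A (mat N N (\<lambda>(i, j). if i < r then u i * A $$ (i, j) else A $$ (i, j)))"
    if "r \<le> N" for r
    using that
  proof (induction r)
    case 0
    have "mat N N (\<lambda>(i, j). if i < 0 then u i * A $$ (i, j) else A $$ (i, j)) = A"
      using A by (intro eq_matI) auto
    then show ?case
      using A by (simp add: reduces_refl)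
  next
    case (Suc r)
    let ?B = "\<lambda>r. mat N N (\<lambda>(i, j). if i < r then u i * A $$ (i, j) else A $$ (i, j))"
    have "?B (Suc r) = multrow r (u r) (?B r)"
      by (rule eq_matI) (auto simp: less_Suc_eq)
    then have "reduces N (?B r) (?B (Suc r))"
      using reduces_multrow[of "?B r" N "u r" r] u Suc.prems by simp
    moreover have "reduces N A (?B r)"
      using Suc by simp
    ultimately show ?case
      by (rule reduces_trans[rotated])
  qed
  from this[of N] have "reduces N A (mat N N (\<lambda>(i, j). if i < N then u i * A $$ (i, j) else A $$ (i, j)))"
    by simp
  moreover have "mat N N (\<lambda>(i, j). if i < N then u i * A $$ (i, j) else A $$ (i, j))
      = mat N N (\<lambda>(i, j). u i * A $$ (i, j))"
    by (rule eq_matI) auto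
  ultimately show ?thesis
    by simp
qed

section \<open>Polynomials as coefficient lists, lowest degree first\<close>

fun poly_add :: "int list \<Rightarrow> int list \<Rightarrow> int list" where
  "poly_add [] q = q"
| "poly_add p [] = p"
| "poly_add (a # p) (b # q) =
     (let r = poly_add p q in if a + b = 0 \<and> r = [] then [] else (a + b) # r)"

fun poly_mult :: "int list \<Rightarrow> int list \<Rightarrow> int list" where
  "poly_mult [] q = []"
| "poly_mult (a # p) q =
     (let r = poly_mult p q in poly_add (map ((*) a) q) (if r = [] then [] else 0 # r))"

text \<open>\<open>poly_add\<close> trims top terms that cancel, but lists need not be normalised:
  \<open>poly_mult [0] [1]\<close> is \<open>[0]\<close>. Zero is therefore tested
  coefficientwise.\<close>

definition poly_zero :: "int list \<Rightarrow> bool" where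
  "poly_zero p \<longleftrightarrow> list_all (\<lambda>c. c = 0) p"

fun monomial :: "int list \<Rightarrow> bool" where
  "monomial [] \<longleftrightarrow> False"
| "monomial (a # p) \<longleftrightarrow> (if a = 0 then monomial p else (a = 1 \<or> a = -1) \<and> poly_zero p)"

abbreviation peval :: "'a :: comm_ring_1 \<Rightarrow> int list \<Rightarrow> 'a" where
  "peval x \<equiv> horner_sum of_int x"

lemma peval_add: "peval x (poly_add p q) = peval x p + peval x q"
proof (induction p q rule: poly_add.induct)
  case (3 a p b q)
  have "peval x (a # p) + peval x (b # q) = of_int (a + b) + x * peval x (poly_add p q)"
    by (simp add: 3 algebra_simps)
  then show ?case
    by (cases "a + b = 0 \<and> poly_add p q = []") (auto simp: Let_def simp del: of_int_add)
qed simp_all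

lemma peval_scale: "peval x (map ((*) a) q) = of_int a * peval x q"
  by (induction q) (auto simp: algebra_simps)

lemma peval_mult: "peval x (poly_mult p q) = peval x p * peval x q"
proof (induction p)
  case (Cons a p)
  have "peval x (if r = [] then [] else 0 # r) = x * peval x r" for r
    by simp
  then show ?case
    using Cons by (simp add: Let_def peval_add peval_scale algebra_simps del: if_split)
qed simp

lemma peval_zero: "poly_zero p \<Longrightarrow> peval x p = 0"
  by (induction p) (auto simp: poly_zero_def)

lemma peval_monomial: "monomial p \<Longrightarrow> \<exists>s k. s \<in> {1, -1} \<and> peval x p = s * x ^ k"
proof (induction p)
  case (Cons a p)
  show ?case
  proof (cases "a = 0")
    case True
    then obtain s k where "s \<in> {1, -1}" "peval x p = s * x ^ k"
      using Cons by auto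
    then have "peval x (a # p) = s * x ^ Suc k"
      using True by simp
    then show ?thesis
      using \<open>s \<in> _\<close> by blast
  next
    case False
    then have "peval x (a # p) = of_int a * x ^ 0" "a = 1 \<or> a = -1"
      using Cons.prems by (auto simp: peval_zero)
    then show ?thesis
      by (metis insertCI of_int_1 of_int_minus)
  qed
qed simp

lemma laurent_unit_monomial: "monomial p \<Longrightarrow> laurent_unit (peval (mpow 1) p)"
  using peval_monomial[of p "mpow 1"] unfolding laurent_unit_def mpow_1_power by blast

section \<open>Row operations on matrices of coefficient lists\<close>

type_synonym row_operation = "nat \<times> int list \<times> int list \<times> nat"

text \<open>The factor \<open>u\<close>, by which row \<open>k\<close> is scaled before the
  addition, avoids the negative powers of \<open>m\<close> that dividing by a monomial pivot would
  bring in.\<close>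

fun valid_operation :: "nat \<Rightarrow> row_operation \<Rightarrow> bool" where
  "valid_operation N (k, u, p, l) \<longleftrightarrow> k < N \<and> l < N - 1 \<and> k \<noteq> l \<and> monomial u"

fun apply_operation :: "row_operation \<Rightarrow> int list list list \<Rightarrow> int list list list" where
  "apply_operation (k, u, p, l) R =
     R[k := map2 (\<lambda>a b. poly_add (poly_mult u a) (poly_mult p b)) (R ! k) (R ! l)]"

definition square :: "nat \<Rightarrow> 'a list list \<Rightarrow> bool" where
  "square N R \<longleftrightarrow> length R = N \<and> (\<forall>i<N. length (R ! i) = N)"

definition laurent_mat :: "nat \<Rightarrow> int list list list \<Rightarrow> laurent mat" where
  "laurent_mat N R = mat N N (\<lambda>(i, j). peval (mpow 1) (R ! i ! j))"

lemma square_apply_operation: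
  "square N R \<Longrightarrow> valid_operation N op \<Longrightarrow> square N (apply_operation op R)"
  by (cases op) (auto simp: square_def nth_list_update)

lemma apply_operation_nth:
  assumes "square N R" "valid_operation N (k, u, p, l)" "i < N" "j < N"
  shows "apply_operation (k, u, p, l) R ! i ! j =
    (if i = k then poly_add (poly_mult u (R ! k ! j)) (poly_mult p (R ! l ! j)) else R ! i ! j)"
  using assms by (auto simp: square_def nth_list_update)

lemma reduces_apply_operation:
  assumes R: "square N R" and op: "valid_operation N op"
  shows "reduces N (laurent_mat N R) (laurent_mat N (apply_operation op R))"
proof -
  obtain k u p l where op': "op = (k, u, p, l)"
    by (cases op)
  have kl: "k < N" "l < N - 1" "k \<noteq> l" and u: "monomial u"
    using op by (auto simp: op')
  let ?A = "laurent_mat N R" and ?u = "peval (mpow 1) u" and ?p = "peval (mpow 1) p :: laurent"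
  have A: "?A \<in> carrier_mat N N"
    by (simp add: laurent_mat_def)
  have "laurent_mat N (apply_operation op R) = addrow ?p k l (multrow k ?u ?A)"
  proof (rule eq_matI)
    fix i j assume "i < dim_row (addrow ?p k l (multrow k ?u ?A))"
      "j < dim_col (addrow ?p k l (multrow k ?u ?A))"
    then have ij: "i < N" "j < N"
      by (simp_all add: laurent_mat_def)
    have "laurent_mat N (apply_operation op R) $$ (i, j) = peval (mpow 1) (apply_operation op R ! i ! j)"
      using ij by (simp add: laurent_mat_def)
    also have "\<dots> = (if i = k then ?u * peval (mpow 1) (R ! k ! j) + ?p * peval (mpow 1) (R ! l ! j)
        else peval (mpow 1) (R ! i ! j))"
      unfolding op' apply_operation_nth[OF R op[unfolded op'] ij] by (simp add: peval_add peval_mult)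
    also have "\<dots> = addrow ?p k l (multrow k ?u ?A) $$ (i, j)"
      using ij kl by (simp add: laurent_mat_def)
    finally show "laurent_mat N (apply_operation op R) $$ (i, j) = addrow ?p k l (multrow k ?u ?A) $$ (i, j)" .
  qed (simp_all add: laurent_mat_def)
  moreover have "reduces N ?A (multrow k ?u ?A)"
    using A u kl by (intro reduces_multrow laurent_unit_monomial)
  moreover have "reduces N (multrow k ?u ?A) (addrow ?p k l (multrow k ?u ?A))"
    using A kl by (intro reduces_addrow) auto
  ultimately show ?thesis
    using reduces_trans by metis
qed

lemma reduces_fold:
  "square N R \<Longrightarrow> list_all (valid_operation N) ops \<Longrightarrow>
   square N (fold apply_operation ops R) \<and>
   reduces N (laurent_mat N R) (laurent_mat N (fold apply_operation ops R))"
proof (induction ops arbitrary: R)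
  case Nil
  then show ?case
    by (simp add: reduces_refl laurent_mat_def)
next
  case (Cons op ops)
  then show ?case
    using square_apply_operation[of N R op] reduces_apply_operation[of N R op] reduces_trans
    by simp
qed

section \<open>Kernels modulo n and reduced matrices\<close>

definition fox_kernel :: "int \<Rightarrow> nat \<Rightarrow> int list list list \<Rightarrow> (nat \<Rightarrow> int) set" where
  "fox_kernel n N R = {z. \<forall>i<N. n dvd (\<Sum>j<N. peval (-1) (R ! i ! j) * z j)}"

text \<open>A new row is a combination of old ones. An upper bound on the number of colourings asks
  for this direction.\<close>

lemma fox_kernel_apply_operation:
  assumes R: "square N R" and op: "valid_operation N op"
  shows "fox_kernel n N R \<subseteq> fox_kernel n N (apply_operation op R)"
proof
  fix z assume z: "z \<in> fox_kernel n N R"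
  obtain k u p l where op': "op = (k, u, p, l)"
    by (cases op)
  have "n dvd (\<Sum>j<N. peval (-1) (apply_operation op R ! i ! j) * z j)" if i: "i < N" for i
  proof (cases "i = k")
    case True
    have "(\<Sum>j<N. peval (-1) (apply_operation op R ! i ! j) * z j)
        = (\<Sum>j<N. peval (-1) u * (peval (-1) (R ! k ! j) * z j) + peval (-1) p * (peval (-1) (R ! l ! j) * z j))"
      using apply_operation_nth[OF R op[unfolded op'] i] True
      by (intro sum.cong) (simp_all add: op' peval_add peval_mult algebra_simps del: of_int_eq_id)
    also have "\<dots> = peval (-1) u * (\<Sum>j<N. peval (-1) (R ! k ! j) * z j)
        + peval (-1) p * (\<Sum>j<N. peval (-1) (R ! l ! j) * z j)"
      by (simp add: sum.distrib sum_distrib_left)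
    finally show ?thesis
      using z op by (auto simp: fox_kernel_def op')
  next
    case False
    have "(\<Sum>j<N. peval (-1) (apply_operation op R ! i ! j) * z j)
        = (\<Sum>j<N. peval (-1) (R ! i ! j) * z j)"
      using apply_operation_nth[OF R op[unfolded op'] i] False
      by (intro sum.cong) (simp_all add: op')
    then show ?thesis
      using z i by (simp add: fox_kernel_def)
  qed
  then show "z \<in> fox_kernel n N (apply_operation op R)"
    by (simp add: fox_kernel_def)
qed

lemma fox_kernel_fold:
  "square N R \<Longrightarrow> list_all (valid_operation N) ops \<Longrightarrow>
   fox_kernel n N R \<subseteq> fox_kernel n N (fold apply_operation ops R)"
proof (induction ops arbitrary: R)
  case (Cons op ops)
  then show ?case
    using square_apply_operation[of N R op] fox_kernel_apply_operation[of N R op n] by simp blast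
qed simp

text \<open>Together with triangularity, the zero row sums encode the end of each row from
  \<open>r\<close> on: the last row is zero, the one before has the form \<alpha>, -\<alpha>, and
  the one before that ends in minus the sum of its two preceding entries.\<close>

definition reduced :: "nat \<Rightarrow> nat \<Rightarrow> int list list list \<Rightarrow> bool" where
  "reduced N r R \<longleftrightarrow>
     list_all (\<lambda>i. list_all poly_zero (take i (R ! i))) [0..<N] \<and>
     list_all (\<lambda>i. monomial (R ! i ! i)) [0..<r] \<and>
     list_all (\<lambda>i. poly_zero (foldr poly_add (R ! i) [])) [r..<N]"

context
  fixes N r :: nat and R :: "int list list list"
  assumes sq: "square N R" and red: "reduced N r R" and r: "r < N"
begin

lemma reduced_lower: "j < i \<Longrightarrow> i < N \<Longrightarrow> peval x (R ! i ! j) = 0"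
  using sq red unfolding reduced_def square_def
  by (auto simp: list_all_length intro!: peval_zero)

lemma reduced_unit: "i < r \<Longrightarrow> monomial (R ! i ! i)"
  using red unfolding reduced_def by (auto simp: list_all_iff)

lemma reduced_sum:
  assumes "r \<le> i" "i < N"
  shows "(\<Sum>j<N. peval x (R ! i ! j)) = 0"
proof -
  have "peval x (foldr poly_add ps []) = (\<Sum>p\<leftarrow>ps. peval x p)" for ps
    by (induction ps) (auto simp: peval_add)
  then have "(\<Sum>p\<leftarrow>R ! i. peval x p) = 0"
    using red assms peval_zero unfolding reduced_def by (metis (no_types, lifting) atLeastLessThan_iff list_all_iff set_upt)
  then show ?thesis
    using sq assms by (simp add: sum_list_sum_nth square_def atLeast0LessThan)
qed

lemma reduced_sum':
  assumes "r \<le> i" "i < N"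
  shows "(\<Sum>j=i..<N. peval x (R ! i ! j)) = 0"
proof -
  have "(\<Sum>j<N. peval x (R ! i ! j)) = (\<Sum>j=i..<N. peval x (R ! i ! j))"
    using assms by (intro sum.mono_neutral_right) (auto simp: not_le reduced_lower)
  then show ?thesis
    using reduced_sum[OF assms, of x] by simp
qed

lemma reduced_normalise:
  obtains B where "reduces N (laurent_mat N R) B" "upper_triangular B"
    "\<And>i. i < r \<Longrightarrow> B $$ (i, i) = 1"
    "\<And>i j. r \<le> i \<Longrightarrow> i < N \<Longrightarrow> j < N \<Longrightarrow> B $$ (i, j) = peval (mpow 1) (R ! i ! j)"
proof -
  have "\<forall>i. \<exists>v. laurent_unit v \<and> (i < r \<longrightarrow> v * peval (mpow 1) (R ! i ! i) = 1) \<and> (r \<le> i \<longrightarrow> v = 1)"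
    using reduced_unit laurent_unit_monomial laurent_unit_inverse laurent_unit_1
    by (metis not_less)
  then obtain v where v: "\<And>i. laurent_unit (v i)"
    "\<And>i. i < r \<Longrightarrow> v i * peval (mpow 1) (R ! i ! i) = 1" "\<And>i. r \<le> i \<Longrightarrow> v i = 1"
    by metis
  let ?B = "mat N N (\<lambda>(i, j). v i * laurent_mat N R $$ (i, j))"
  have "reduces N (laurent_mat N R) ?B"
    using v(1) by (intro reduces_scale) (auto simp: laurent_mat_def)
  moreover have "upper_triangular ?B"
    by (intro upper_triangularI) (simp add: laurent_mat_def reduced_lower)
  ultimately show thesis
    using that[of ?B] v r by (auto simp: laurent_mat_def)
qed

lemma reduced_det:
  "\<exists>u. laurent_unit u \<and> det (mat_delete (laurent_mat N R) (N - 1) (N - 1)) =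
     u * (\<Prod>i=r..<N-1. peval (mpow 1) (R ! i ! i))"
proof -
  let ?C = "mat_delete (laurent_mat N R) (N - 1) (N - 1)"
  have C: "?C = mat (N - 1) (N - 1) (\<lambda>ij. laurent_mat N R $$ ij)"
    by (rule mat_delete_last) (simp add: laurent_mat_def)
  have "upper_triangular ?C"
    unfolding C by (intro upper_triangularI) (simp add: laurent_mat_def reduced_lower)
  then have "det ?C = (\<Prod>i<N-1. peval (mpow 1) (R ! i ! i))"
    unfolding C by (subst det_upper_triangular[where n = "N - 1"])
      (auto simp: prod_list_diag_prod laurent_mat_def atLeast0LessThan intro!: prod.cong)
  also have "{..<N-1} = {..<r} \<union> {r..<N-1}"
    using r by auto
  also have "(\<Prod>i\<in>{..<r} \<union> {r..<N-1}. peval (mpow 1) (R ! i ! i)) =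
      (\<Prod>i<r. peval (mpow 1) (R ! i ! i)) * (\<Prod>i=r..<N-1. peval (mpow 1) (R ! i ! i) :: laurent)"
    by (intro prod.union_disjoint) auto
  finally show ?thesis
    using reduced_unit laurent_unit_monomial laurent_unit_prod
    by (metis (no_types, lifting) lessThan_iff)
qed

text \<open>Back substitution from the last row upwards: a monomial pivot becomes 1 or -1 at m = -1,
  so it can be cancelled modulo any \<open>n\<close>, including the composite modulus 6.\<close>

lemma reduced_fox_kernel:
  assumes z: "z \<in> fox_kernel n N R" and last: "\<And>i. r \<le> i \<Longrightarrow> i < N \<Longrightarrow> n dvd z i"
  shows "i < N \<Longrightarrow> n dvd z i"
proof (induction "N - i" arbitrary: i rule: less_induct)
  case less
  show ?case
  proof (cases "r \<le> i")
    case False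
    have "(\<Sum>j<N. peval (-1) (R ! i ! j) * z j) =
        peval (-1) (R ! i ! i) * z i + (\<Sum>j\<in>{..<N}-{i}. peval (-1) (R ! i ! j) * z j)"
      using less.prems by (simp add: sum.remove)
    moreover have "n dvd (\<Sum>j\<in>{..<N}-{i}. peval (-1) (R ! i ! j) * z j)"
    proof (rule dvd_sum)
      fix j assume j: "j \<in> {..<N} - {i}"
      show "n dvd peval (-1) (R ! i ! j) * z j"
      proof (cases "j < i")
        case True
        then show ?thesis
          using reduced_lower[of j i "-1 :: int"] less.prems by (simp del: of_int_eq_id)
      next
        case False
        then have "n dvd z j"
          using j less.hyps[of j] by auto
        then show ?thesis
          by simp
      qed
    qed
    moreover have "n dvd (\<Sum>j<N. peval (-1) (R ! i ! j) * z j)"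
      using z less.prems by (simp add: fox_kernel_def)
    ultimately have "n dvd peval (-1) (R ! i ! i) * z i"
      by (simp add: dvd_add_left_iff)
    moreover obtain s k where "s \<in> {1, -1 :: int}" "peval (-1) (R ! i ! i) = s * (-1) ^ k"
      using peval_monomial reduced_unit False by (metis not_less)
    ultimately show ?thesis
      by (cases "even k") auto
  qed (use last less.prems in simp)
qed

end

section \<open>Checking diagrams\<close>

primrec index_of :: "'a \<Rightarrow> 'a list \<Rightarrow> nat" where
  "index_of x [] = 0"
| "index_of x (y # ys) = (if x = y then 0 else Suc (index_of x ys))"

lemma index_of_nth: "x \<in> set xs \<Longrightarrow> index_of x xs < length xs \<and> xs ! index_of x xs = x"
  by (induction xs) auto

text \<open>Executable form of \<open>position\<close>, whose definite description cannot be
  evaluated.\<close>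

definition find_passage :: "gauss \<Rightarrow> level \<Rightarrow> nat \<Rightarrow> nat" where
  "find_passage D l c = index_of (l, c) (map (\<lambda>(l, c, s). (l, c)) D)"

lemma find_passage_eq:
  assumes D: "valid_code D" and c: "c \<in> crossings D"
  shows "find_passage D l c = position D l c"
proof -
  let ?k = "\<lambda>(l :: level, c :: nat, s :: bool). (l, c)"
  obtain i s where i: "i < length D" "D ! i = (l, c, s)" "position D l c = i"
    using valid_code_occurs[OF D c] .
  then have "(l, c) \<in> set (map ?k D)"
    by (metis (mono_tags, lifting) case_prod_conv length_map nth_map nth_mem)
  then have "find_passage D l c < length D \<and> map ?k D ! find_passage D l c = map ?k D ! i"
    using index_of_nth[of "(l, c)" "map ?k D"] i unfolding find_passage_def by simp
  moreover have "distinct (map ?k D)"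
    using D by (simp add: valid_code_def)
  ultimately show ?thesis
    using i by (metis length_map nth_eq_iff_index_eq)
qed

text \<open>Executable form of \<open>turn_left\<close>, with case distinctions in place of
  \<open>mod\<close>.\<close>

fun turn :: "gauss \<Rightarrow> nat \<times> bool \<Rightarrow> nat \<times> bool" where
  "turn D (i, forward) =
     (let (l, c, s) = D ! (if forward then if Suc i = length D then 0 else Suc i else i);
          j = find_passage D (opposite l) c
      in if forward \<longleftrightarrow> ((l = Over) \<longleftrightarrow> s) then (j, True)
         else (if j = 0 then length D - 1 else j - 1, False))"

lemma turn_eq:
  assumes D: "valid_code D" and i: "i < length D"
  shows "turn D (i, forward) = turn_left D (i, forward)"
proof -
  define k where "k = (if forward then if Suc i = length D then 0 else Suc i else i)"
  have k: "k < length D" "k = (if forward then Suc i mod length D else i)"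
    using i by (auto simp: k_def)
  obtain l c s where lcs: "D ! k = (l, c, s)"
    by (cases "D ! k")
  have c: "c \<in> crossings D"
    using k(1) lcs unfolding crossings_def by (metis (mono_tags, lifting) case_prod_conv image_iff nth_mem)
  obtain j s' where j: "j < length D" "position D (opposite l) c = j"
    using valid_code_occurs[OF D c] by metis
  have "(if j = 0 then length D - 1 else j - 1) = (j + length D - 1) mod length D"
  proof (cases "j = 0")
    case False
    then have *: "j + length D - 1 = (j - 1) + length D" "(j - 1) mod length D = j - 1"
      using j by simp_all
    show ?thesis
      unfolding *(1) mod_add_self2 using False *(2) by simp
  qed (use i in auto)
  then show ?thesis
    unfolding turn.simps turn_left.simps k_def[symmetric] k(2)[symmetric] lcs Let_def prod.case
      find_passage_eq[OF D c] j(2) by auto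
qed

section \<open>Counting orbits by checked cycles\<close>

primrec trace :: "('a \<Rightarrow> 'a) \<Rightarrow> 'a \<Rightarrow> 'a \<Rightarrow> nat \<Rightarrow> 'a list" where
  "trace f x y 0 = []"
| "trace f x y (Suc k) = y # (let z = f y in if z = x then [] else trace f x z k)"

text \<open>The traced list is verified rather than trusted: \<open>map f os = rotate1 os\<close>
  makes it a complete cycle, whatever the fuel \<open>k\<close>. \<open>P\<close> marks the points
  at which \<open>f\<close> may be exchanged for the specified map, and \<open>m > 0\<close> guards
  the truncated subtraction.\<close>

function orbit_count :: "('a \<Rightarrow> bool) \<Rightarrow> ('a \<Rightarrow> 'a) \<Rightarrow> nat \<Rightarrow> 'a list \<Rightarrow> nat \<Rightarrow> bool" where
  "orbit_count P f k [] m \<longleftrightarrow> m = 0"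
| "orbit_count P f k (x # xs) m \<longleftrightarrow>
     (let os = trace f x x k
      in m > 0 \<and> x \<in> set os \<and> list_all P os \<and> map f os = rotate1 os \<and>
         orbit_count P f k (filter (\<lambda>y. y \<notin> set os) xs) (m - 1))"
  by pat_completeness auto
termination
  by (relation "measure (\<lambda>(P, f, k, xs, m). length xs)") (auto simp: le_imp_less_Suc)

lemma orbit_cycle:
  assumes cyc: "map f os = rotate1 os" and x: "x \<in> set os"
  shows "orbit f x = set os"
proof -
  let ?n = "length os"
  obtain i where i: "i < ?n" "os ! i = x"
    using x by (auto simp: in_set_conv_nth)
  have step: "f (os ! j) = os ! (Suc j mod ?n)" if "j < ?n" for j
    using arg_cong[OF cyc, of "\<lambda>ys. ys ! j"] that by (simp add: nth_rotate1)
  have n: "?n > 0"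
    using i(1) by linarith
  have iter: "(f ^^ k) x = os ! ((i + k) mod ?n)" for k
  proof (induction k)
    case (Suc k)
    then show ?case
      using step[OF mod_less_divisor[OF n], of "i + k"] by (simp add: mod_Suc_eq)
  qed (use i in auto)
  have "os ! j \<in> orbit f x" if j: "j < ?n" for j
  proof -
    \<comment> \<open>One full turn is added because \<open>orbit\<close> consists of the positive
      iterates, while \<open>j - i\<close> may be zero or negative.\<close>
    have "(f ^^ (j + ?n - i)) x = os ! j"
      using i j by (simp add: iter)
    moreover have "j + ?n - i > 0"
      using i by simp
    ultimately show ?thesis
      unfolding orbit_altdef mem_Collect_eq by (intro exI[of _ "j + ?n - i"]) simp
  qed
  then have "set os \<subseteq> orbit f x"
    by (auto simp: in_set_conv_nth)
  moreover have "(f ^^ k) x \<in> set os" for k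
    using n by (simp add: iter)
  then have "orbit f x \<subseteq> set os"
    unfolding orbit_altdef by blast
  ultimately show ?thesis
    by blast
qed

text \<open>That every point lies in its own orbit is carried through the induction to see that a
  new cycle is not counted twice: if it were the orbit of a later point, that point would lie on it
  and would have been filtered out.\<close>

lemma orbit_count_card:
  assumes "orbit_count P g k xs m" and eq: "\<And>x. P x \<Longrightarrow> g x = f x"
  shows "card (orbit f ` set xs) = m \<and> (\<forall>x\<in>set xs. x \<in> orbit f x)"
  using assms(1)
proof (induction xs arbitrary: m rule: length_induct)
  case (1 xs)
  show ?case
  proof (cases xs)
    case Nil
    then show ?thesis
      using 1 by simp
  next
    case (Cons x ys)
    define os where "os = trace g x x k"
    define zs where "zs = filter (\<lambda>y. y \<notin> set os) ys"
    have os: "m > 0" "x \<in> set os" "list_all P os" "map g os = rotate1 os"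
      "orbit_count P g k zs (m - 1)"
      using 1(2) Cons by (simp_all add: os_def zs_def Let_def)
    have "map g os = map f os"
    proof (rule map_cong[OF refl])
      fix y assume "y \<in> set os"
      then have "P y"
        using os(3) by (metis list_all_iff)
      then show "g y = f y"
        by (rule eq)
    qed
    then have "map f os = rotate1 os"
      using os(4) by simp
    then have cyc: "orbit f y = set os" if "y \<in> set os" for y
      using that by (rule orbit_cycle)
    have "length zs < length xs"
      using Cons by (simp add: zs_def le_imp_less_Suc)
    from 1(1)[rule_format, OF this os(5)]
    have IH: "card (orbit f ` set zs) = m - 1" "\<forall>y\<in>set zs. y \<in> orbit f y"
      by blast+
    have "orbit f ` set xs = insert (set os) (orbit f ` set zs)"
    proof -
      have "set xs = insert x (set zs \<union> (set ys \<inter> set os))"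
        using Cons by (auto simp: zs_def)
      then show ?thesis
        using cyc os(2) by auto
    qed
    moreover have "set os \<notin> orbit f ` set zs"
      using IH(2) by (auto simp: zs_def)
    moreover have "y \<in> orbit f y" if "y \<in> set xs" for y
      using that IH(2) cyc os(2) Cons by (cases "y \<in> set os") (auto simp: zs_def)
    ultimately show ?thesis
      using IH(1) os(1) by simp
  qed
qed

text \<open>The fuel \<open>2 * length D\<close> is the number of directed edges, which no face
  boundary exceeds.\<close>

definition diagram_check :: "gauss \<Rightarrow> bool" where
  "diagram_check D \<longleftrightarrow> D \<noteq> [] \<and> distinct (map (\<lambda>(l, c, s). (l, c)) D) \<and>
     list_all (\<lambda>(l, c, s). (opposite l, c, s) \<in> set D) D \<and>
     orbit_count (\<lambda>(i, b). i < length D) (turn D) (2 * length D)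
       (List.product [0..<length D] [True, False]) (card (crossings D) + 2)"

lemma diagram_check:
  assumes "diagram_check D"
  shows "knot_diagram D"
proof -
  have "(opposite l, c, s) \<in> set D" if "(l, c, s) \<in> set D" for l c s
    using assms that unfolding diagram_check_def list_all_iff by blast
  then have "(Over, c, s) \<in> set D \<longleftrightarrow> (Under, c, s) \<in> set D" for c s
    by (metis opposite.simps)
  then have D: "valid_code D"
    using assms unfolding diagram_check_def valid_code_def by blast
  have darts: "set (List.product [0..<length D] [True, False]) = {..<length D} \<times> UNIV"
    by auto
  have "turn D x = turn_left D x" if "(\<lambda>(i, b). i < length D) x" for x
    using turn_eq[OF D] that by (cases x) simp
  then have "card (faces D) = card (crossings D) + 2"
    using assms orbit_count_card[where P = "\<lambda>(i, b). i < length D" and g = "turn D" and f = "turn_left D"]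
    unfolding diagram_check_def faces_def darts[symmetric] by blast
  then show ?thesis
    using D by (simp add: knot_diagram_def valid_code_def)
qed

section \<open>Checking reductions\<close>

text \<open>Here \<open>i\<close>, \<open>j\<close> and \<open>c\<close> are the incoming under-arc,
  the over-arc and the outgoing under-arc; the contributions are added because these arcs may
  coincide.\<close>

definition initial_entry :: "bool \<Rightarrow> nat \<Rightarrow> nat \<Rightarrow> nat \<Rightarrow> nat \<Rightarrow> int list" where
  "initial_entry s i j c a =
     poly_add (if a = i then if s then [0, 1] else [1] else [])
       (poly_add (if a = j then if s then [1, -1] else [-1, 1] else [])
         (if a = c then if s then [-1] else [0, -1] else []))"

text \<open>The rows of negative crossings are multiplied by \<open>m\<close> to obtain polynomials.\<close>

definition initial_row :: "gauss \<Rightarrow> nat list \<Rightarrow> nat \<Rightarrow> int list list" where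
  "initial_row D cs c =
     (let s = positive D c; i = arc_into D (find_passage D Under c); j = arc_into D (find_passage D Over c)
      in map (initial_entry s i j c) cs)"

lemma peval_initial_entry:
  "peval x (initial_entry s i j c a) =
     (if s then (if a = i then x else 0) + (if a = j then 1 - x else 0) - (if a = c then 1 else 0)
      else (if a = i then 1 else 0) + (if a = j then x - 1 else 0) - (if a = c then x else 0))"
  by (simp add: initial_entry_def peval_add)

lemma initial_row_nth:
  assumes "valid_code D" "c \<in> crossings D" "l < length cs"
  shows "initial_row D cs c ! l = initial_entry (positive D c) (under_in D c) (over_arc D c) c (cs ! l)"
  using assms by (simp add: initial_row_def find_passage_eq under_in_def over_arc_def Let_def)

lemma reduces_initial:
  assumes D: "valid_code D" and rs: "set rs = crossings D" "length rs = N" "length cs = N"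
  shows "reduces N (matrix_of_numbering D rs cs) (laurent_mat N (map (initial_row D cs) rs))"
proof -
  let ?A = "matrix_of_numbering D rs cs"
  define v where "v = (\<lambda>k. if positive D (rs ! k) then 1 else mpow 1)"
  have "laurent_mat N (map (initial_row D cs) rs) = mat N N (\<lambda>(k, l). v k * ?A $$ (k, l))"
  proof (rule eq_matI)
    fix k l assume "k < dim_row (mat N N (\<lambda>(k, l). v k * ?A $$ (k, l)))"
      "l < dim_col (mat N N (\<lambda>(k, l). v k * ?A $$ (k, l)))"
    then have kl: "k < N" "l < N"
      by simp_all
    have "rs ! k \<in> crossings D"
      using rs kl nth_mem[of k rs] by simp
    moreover have "mpow 1 * mpow (- 1) = 1"
      using mpow_add[of 1 "- 1"] by simp
    ultimately show "laurent_mat N (map (initial_row D cs) rs) $$ (k, l) =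
        mat N N (\<lambda>(k, l). v k * ?A $$ (k, l)) $$ (k, l)"
      using kl rs initial_row_nth[OF D, of "rs ! k" l cs]
      by (simp add: laurent_mat_def matrix_of_numbering_def peval_initial_entry v_def Let_def
          right_diff_distrib distrib_left)
  qed (simp_all add: laurent_mat_def)
  moreover have "reduces N ?A (mat N N (\<lambda>(k, l). v k * ?A $$ (k, l)))"
    using rs laurent_unit_1 laurent_unit_mpow
    by (intro reduces_scale) (auto simp: matrix_of_numbering_def v_def)
  ultimately show ?thesis
    by simp
qed

lemma initial_fox_kernel:
  assumes D: "valid_code D" and rs: "set rs = crossings D" "length rs = N"
    and cs: "distinct cs" "set cs = crossings D" "length cs = N"
    and X: "X \<in> fox_colourings n D" "Y \<in> fox_colourings n D"
  shows "(\<lambda>l. X (cs ! l) - Y (cs ! l)) \<in> fox_kernel n N (map (initial_row D cs) rs)"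
  unfolding fox_kernel_def
proof (intro CollectI allI impI)
  fix k assume k: "k < N"
  define c where "c = rs ! k"
  have c: "c \<in> crossings D"
    using k rs nth_mem[of k rs] by (simp add: c_def)
  let ?i = "under_in D c" and ?j = "over_arc D c"
  let ?e = "\<lambda>a. peval (-1) (initial_entry (positive D c) ?i ?j c a) :: int"
  have arcs: "?i \<in> crossings D" "?j \<in> crossings D"
    using D arc_into_crossing unfolding under_in_def over_arc_def by blast+
  have bij: "bij_betw ((!) cs) {..<N} (crossings D)"
    using cs by (intro bij_betw_nth) auto
  have row: "n dvd (\<Sum>a\<in>crossings D. ?e a * Z a)" if Z: "Z \<in> fox_colourings n D" for Z
  proof -
    \<comment> \<open>At m = -1 the rows of both signs become the same relation
      \<open>Z i - 2 * Z j + Z c\<close> up to sign.\<close>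
    have e: "?e a * Z a = (if positive D c then -1 else 1) *
        ((if a = ?i then Z a else 0) + (if a = ?j then - 2 * Z a else 0) + (if a = c then Z a else 0))" for a
      by (simp add: peval_initial_entry algebra_simps del: of_int_eq_id)
    have "(\<Sum>a\<in>crossings D. ?e a * Z a) = (if positive D c then -1 else 1) * (Z ?i - 2 * Z ?j + Z c)"
      unfolding e sum_distrib_left[symmetric] sum.distrib using arcs c by simp
    moreover have "n dvd Z ?i - 2 * Z ?j + Z c"
    proof -
      have "Z c = (2 * Z ?j - Z ?i) mod n"
        using Z c by (simp add: fox_colourings_def)
      then have "[Z c = 2 * Z ?j - Z ?i] (mod n)"
        by (simp add: cong_def)
      then show ?thesis
        by (simp add: cong_iff_dvd_diff algebra_simps)
    qed
    ultimately show ?thesis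
      by simp
  qed
  have "(\<Sum>l<N. peval (-1) (map (initial_row D cs) rs ! k ! l) * (X (cs ! l) - Y (cs ! l))) =
      (\<Sum>l<N. ?e (cs ! l) * (X (cs ! l) - Y (cs ! l)))"
    using k rs cs initial_row_nth[OF D c] by (intro sum.cong) (simp_all add: c_def)
  also have "\<dots> = (\<Sum>a\<in>crossings D. ?e a * (X a - Y a))"
    using bij by (rule sum.reindex_bij_betw)
  also have "\<dots> = (\<Sum>a\<in>crossings D. ?e a * X a) - (\<Sum>a\<in>crossings D. ?e a * Y a)"
    by (simp add: right_diff_distrib sum_subtractf)
  finally show "n dvd (\<Sum>l<N. peval (-1) (map (initial_row D cs) rs ! k ! l) * (X (cs ! l) - Y (cs ! l)))"
    using row[OF X(1)] row[OF X(2)] by simp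
qed

text \<open>
  The reduced matrix has \<open>d\<close> diagonal entries besides the units and the final zero, so \<open>d = 1\<close> for
  type I and \<open>d = 2\<close> for type II; their product agrees with \<open>\<alpha>\<close> up to a unit. Dropping
  leading zeros of a coefficient list divides by a power of \<open>m\<close>.
\<close>

definition reduction_check ::
    "nat \<Rightarrow> gauss \<Rightarrow> nat list \<Rightarrow> nat list \<Rightarrow> row_operation list \<Rightarrow> int list \<Rightarrow> bool" where
  "reduction_check d D rs cs ops \<alpha> \<longleftrightarrow>
     diagram_check D \<and>
     distinct rs \<and> set rs = crossings D \<and> distinct cs \<and> set cs = crossings D \<and>
     d < length rs \<and> list_all (valid_operation (length rs)) ops \<and>
     (let N = length rs; R = fold apply_operation ops (map (initial_row D cs) rs);
          p = dropWhile (\<lambda>c. c = 0) (foldr poly_mult (map (\<lambda>i. R ! i ! i) [N - 1 - d..<N - 1]) [1])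
      in reduced N (N - 1 - d) R \<and> (p = \<alpha> \<or> p = map uminus \<alpha>))"

lemma peval_dropWhile: "\<exists>k. peval x p = x ^ k * peval x (dropWhile (\<lambda>c. c = 0) p)"
proof (induction p)
  case (Cons a p)
  then obtain k where k: "peval x p = x ^ k * peval x (dropWhile (\<lambda>c. c = 0) p)"
    by blast
  show ?case
  proof (cases "a = 0")
    case True
    then have "peval x (a # p) = x ^ Suc k * peval x (dropWhile (\<lambda>c. c = 0) (a # p))"
      by (simp add: k mult.assoc)
    then show ?thesis
      by blast
  next
    case False
    then show ?thesis
      by (intro exI[of _ 0]) simp
  qed
qed (auto intro: exI[of _ 0])

lemma peval_uminus: "peval x (map uminus p) = - peval x p"
  by (induction p) simp_all

lemma peval_prod: "peval x (foldr poly_mult (map f [i..<j]) [1]) = (\<Prod>k=i..<j. peval x (f k))"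
proof -
  have "peval x (foldr poly_mult ps [1]) = (\<Prod>p\<leftarrow>ps. peval x p)" for ps
    by (induction ps) (simp_all add: peval_mult)
  then show ?thesis
    by (simp add: prod.distinct_set_conv_list[symmetric] comp_def)
qed

context
  fixes d D rs cs ops \<alpha>
  assumes check: "reduction_check d D rs cs ops \<alpha>"
begin

private abbreviation "N \<equiv> length rs"
private abbreviation "r \<equiv> N - 1 - d"
private abbreviation "A \<equiv> matrix_of_numbering D rs cs"
private definition "R = fold apply_operation ops (map (initial_row D cs) rs)"

lemma check_diagram: "knot_diagram D" "valid_code D"
  using check diagram_check knot_diagram_valid unfolding reduction_check_def by blast+

lemma check_base: "D \<in> knot D"
  using check_diagram by (simp add: knot_def)

private lemma lists: "set rs = crossings D" "distinct cs" "set cs = crossings D" "length cs = N" "d < N" "r < N"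
  "distinct rs"
proof -
  show "set rs = crossings D" "distinct cs" "set cs = crossings D" "d < N" "distinct rs"
    using check unfolding reduction_check_def by blast+
  then show "length cs = N" "r < N"
    using distinct_card by (metis, simp)
qed

private lemma R: "square N R" "reduced N r R" "reduces N A (laurent_mat N R)"
proof -
  have sq: "square N (map (initial_row D cs) rs)"
    using lists by (simp add: square_def initial_row_def Let_def)
  have ops: "list_all (valid_operation N) ops"
    using check unfolding reduction_check_def by blast
  show "square N R" "reduces N A (laurent_mat N R)"
    using reduces_fold[OF sq ops] reduces_initial[OF check_diagram(2)] lists reduces_trans
    unfolding R_def by blast+
  show "reduced N r R"
    using check unfolding reduction_check_def R_def Let_def by blast
qed

private lemma A: "colouring_matrix D A"
  using lists unfolding colouring_matrix_def by blast

text \<open>Three units lie between \<open>\<alpha>\<close> and the minor of the colouring matrix: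
  \<open>u1\<close> from the row operations, \<open>u2\<close> from the monomial pivots, and
  \<open>u3\<close> from the dropped power of \<open>m\<close> and the sign. Inverting
  \<open>u2 * u3\<close> leaves a single factor of the form that \<open>alexander_polynomial\<close>
  allows, with \<open>D\<close> as witness.\<close>

lemma check_alexander: "alexander_polynomial (knot D) (peval (mpow 1) \<alpha>)"
proof -
  let ?p = "foldr poly_mult (map (\<lambda>i. R ! i ! i) [r..<N - 1]) [1]"
  let ?del = "\<lambda>A. mat_delete A (N - 1) (N - 1)"
  obtain u1 where u1: "laurent_unit u1" "det (?del (laurent_mat N R)) = u1 * det (?del A)"
    using R(3) unfolding reduces_def by blast
  obtain u2 where u2: "laurent_unit u2" "det (?del (laurent_mat N R)) = u2 * peval (mpow 1) ?p"
    using reduced_det[OF R(1,2) lists(6)] unfolding peval_prod by blast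
  obtain k where k: "peval (mpow 1) ?p = mpow (int k) * peval (mpow 1) (dropWhile (\<lambda>c. c = 0) ?p)"
    using peval_dropWhile[of "mpow 1" ?p] unfolding mpow_1_power by blast
  have "dropWhile (\<lambda>c. c = 0) ?p = \<alpha> \<or> dropWhile (\<lambda>c. c = 0) ?p = map uminus \<alpha>"
    using check unfolding reduction_check_def R_def Let_def by blast
  then have "peval (mpow 1) ?p = mpow (int k) * peval (mpow 1) \<alpha> \<or>
      peval (mpow 1) ?p = - mpow (int k) * peval (mpow 1) \<alpha>"
    unfolding k by (elim disjE) (simp_all add: peval_uminus)
  moreover have "laurent_unit (- mpow (int k))"
    using laurent_unit_mult[OF laurent_unit_uminus_1 laurent_unit_mpow] by simp
  ultimately have "\<exists>u. laurent_unit u \<and> peval (mpow 1) ?p = u * peval (mpow 1) \<alpha>"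
    using laurent_unit_mpow by blast
  then obtain u3 where u3: "laurent_unit u3" "peval (mpow 1) ?p = u3 * peval (mpow 1) \<alpha>"
    by blast
  obtain w where w: "laurent_unit w" "w * (u2 * u3) = 1"
    using laurent_unit_inverse[OF laurent_unit_mult[OF u2(1) u3(1)]] .
  have "peval (mpow 1) \<alpha> = w * (u2 * u3) * peval (mpow 1) \<alpha>"
    by (simp add: w)
  also have "\<dots> = w * u1 * det (?del A)"
    using u1(2) u2(2) u3(2) by (simp add: mult.assoc)
  finally have "peval (mpow 1) \<alpha> = w * u1 * det (?del A)" .
  moreover obtain s j where "s \<in> {1, -1}" "w * u1 = s * mpow j"
    using laurent_unit_mult[OF w(1) u1(1)] unfolding laurent_unit_def by blast
  moreover have "dim_row A = N" "dim_col A = N"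
    using lists by (simp_all add: matrix_of_numbering_def)
  ultimately show ?thesis
    unfolding alexander_polynomial_def using check_base A by metis
qed

private lemma normal_form:
  obtains B where "matrix_equivalent A B" "B \<in> carrier_mat N N" "upper_triangular B"
    "\<And>i. i < r \<Longrightarrow> B $$ (i, i) = 1"
    "\<And>i. r \<le> i \<Longrightarrow> i < N \<Longrightarrow> (\<Sum>j=i..<N. B $$ (i, j)) = 0"
proof -
  obtain B where B: "reduces N (laurent_mat N R) B" "upper_triangular B"
    "\<And>i. i < r \<Longrightarrow> B $$ (i, i) = 1"
    "\<And>i j. r \<le> i \<Longrightarrow> i < N \<Longrightarrow> j < N \<Longrightarrow> B $$ (i, j) = peval (mpow 1) (R ! i ! j)"
    by (rule reduced_normalise[OF R(1,2) lists(6)]) (rule that, assumption+)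
  have "(\<Sum>j=i..<N. B $$ (i, j)) = 0" if "r \<le> i" "i < N" for i
    using reduced_sum'[OF R(1,2) lists(6) that, of "mpow 1"] B(4) that by simp
  moreover have "matrix_equivalent A B" "B \<in> carrier_mat N N"
    using reduces_trans[OF R(3) B(1)] by (simp_all add: reduces_def)
  ultimately show thesis
    using that B by blast
qed

lemma check_type_I:
  assumes d: "d = 1"
  shows "type_I (knot D)"
proof -
  obtain B where B: "matrix_equivalent A B" "B \<in> carrier_mat N N" "upper_triangular B"
    "\<And>i. i < r \<Longrightarrow> B $$ (i, i) = 1"
    "\<And>i. r \<le> i \<Longrightarrow> i < N \<Longrightarrow> (\<Sum>j=i..<N. B $$ (i, j)) = 0"
    by (rule normal_form) (rule that, assumption+)
  have N: "N \<ge> 2" "r = N - 2"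
    using lists d by auto
  have "{N - 2..<N} = {N - 2, N - 1}" "N - 2 \<noteq> N - 1"
    using N by auto
  moreover have "(\<Sum>j=N-2..<N. B $$ (N - 2, j)) = 0"
    using B(5)[of "N - 2"] N by simp
  ultimately have b2: "B $$ (N - 2, N - 2) + B $$ (N - 2, N - 1) = 0"
    by simp
  have "{N - 1..<N} = {N - 1}"
    using N by auto
  moreover have "(\<Sum>j=N-1..<N. B $$ (N - 1, j)) = 0"
    using B(5)[of "N - 1"] N by simp
  ultimately have b1: "B $$ (N - 1, N - 1) = 0"
    by simp
  have "B $$ (N - 2, N - 1) = - B $$ (N - 2, N - 2)"
    using b2 by (simp add: add_eq_0_iff)
  moreover have "\<forall>i < N - 2. B $$ (i, i) = 1"
    using B(4) N by simp
  ultimately have "type_I_matrix B"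
    unfolding type_I_matrix_def using B(2,3) N(1) b1 by blast
  then show ?thesis
    unfolding type_I_def using check_base A B(1) by blast
qed

lemma check_type_II:
  assumes d: "d = 2"
  shows "type_II (knot D)"
proof -
  obtain B where B: "matrix_equivalent A B" "B \<in> carrier_mat N N" "upper_triangular B"
    "\<And>i. i < r \<Longrightarrow> B $$ (i, i) = 1"
    "\<And>i. r \<le> i \<Longrightarrow> i < N \<Longrightarrow> (\<Sum>j=i..<N. B $$ (i, j)) = 0"
    by (rule normal_form) (rule that, assumption+)
  have N: "N \<ge> 3" "r = N - 3"
    using lists d by auto
  have "{N - 3..<N} = {N - 3, N - 2, N - 1}" "N - 3 \<noteq> N - 2" "N - 3 \<noteq> N - 1" "N - 2 \<noteq> N - 1"
    using N by auto
  moreover have "(\<Sum>j=N-3..<N. B $$ (N - 3, j)) = 0"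
    using B(5)[of "N - 3"] N by simp
  ultimately have b3: "B $$ (N - 3, N - 3) + (B $$ (N - 3, N - 2) + B $$ (N - 3, N - 1)) = 0"
    by simp
  have "{N - 2..<N} = {N - 2, N - 1}" "N - 2 \<noteq> N - 1"
    using N by auto
  moreover have "(\<Sum>j=N-2..<N. B $$ (N - 2, j)) = 0"
    using B(5)[of "N - 2"] N by simp
  ultimately have b2: "B $$ (N - 2, N - 2) + B $$ (N - 2, N - 1) = 0"
    by simp
  have "{N - 1..<N} = {N - 1}"
    using N by auto
  moreover have "(\<Sum>j=N-1..<N. B $$ (N - 1, j)) = 0"
    using B(5)[of "N - 1"] N by simp
  ultimately have b1: "B $$ (N - 1, N - 1) = 0"
    by simp
  have "B $$ (N - 3, N - 1) = - (B $$ (N - 3, N - 3) + B $$ (N - 3, N - 2))"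
    using b3 by (simp add: add_eq_0_iff add.assoc[symmetric])
  moreover have "B $$ (N - 2, N - 1) = - B $$ (N - 2, N - 2)"
    using b2 by (simp add: add_eq_0_iff)
  moreover have "\<forall>i < N - 3. B $$ (i, i) = 1"
    using B(4) N by simp
  ultimately have "type_II_matrix B"
    unfolding type_II_matrix_def using B(2,3) N(1) b1 by blast
  then show ?thesis
    unfolding type_II_def using check_base A B(1) by blast
qed

text \<open>If two colourings agree on the last \<open>d + 1\<close> arcs of \<open>cs\<close>,
  their difference lies in the kernel of the reduced matrix and vanishes modulo \<open>n\<close> by
  back substitution. So restricting to these arcs is injective.\<close>

lemma check_card_fox_colourings:
  "card (fox_colourings n D) \<le> nat n ^ (d + 1)"
proof -
  let ?I = "{r..<N}"
  define f where "f = (\<lambda>X. restrict (\<lambda>l. X (cs ! l)) ?I :: nat \<Rightarrow> int)"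
  have "inj_on f (fox_colourings n D)"
  proof (rule inj_onI)
    fix X Y assume X: "X \<in> fox_colourings n D" and Y: "Y \<in> fox_colourings n D" and fXY: "f X = f Y"
    define z where "z = (\<lambda>l. X (cs ! l) - Y (cs ! l))"
    have "z \<in> fox_kernel n N (map (initial_row D cs) rs)"
      unfolding z_def using lists X Y by (intro initial_fox_kernel check_diagram) auto
    then have z: "z \<in> fox_kernel n N R"
      using fox_kernel_fold[of N "map (initial_row D cs) rs" ops n] check lists
      unfolding R_def reduction_check_def by (auto simp: square_def initial_row_def Let_def)
    have "z l = 0" if "l \<in> ?I" for l
      using fun_cong[OF fXY, of l] that by (simp add: f_def z_def)
    then have dvd: "n dvd z l" if "l < N" for l
      using reduced_fox_kernel[OF R(1,2) lists(6) z _ that] by simp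
    have "X c = Y c" if c: "c \<in> crossings D" for c
    proof -
      obtain l where l: "l < N" "cs ! l = c"
        using c lists by (metis in_set_conv_nth)
      have "X c \<in> {0..<n}" "Y c \<in> {0..<n}"
        using X Y c unfolding fox_colourings_def by blast+
      moreover have "[X c = Y c] (mod n)"
        using dvd[OF l(1)] l(2) by (simp add: cong_iff_dvd_diff z_def)
      ultimately show ?thesis
        by (simp add: cong_def)
    qed
    then show "X = Y"
      using X Y unfolding fox_colourings_def by (blast intro: PiE_ext)
  qed
  moreover have "f ` fox_colourings n D \<subseteq> ?I \<rightarrow>\<^sub>E {0..<n}"
  proof
    fix g assume "g \<in> f ` fox_colourings n D"
    then obtain X where X: "X \<in> fox_colourings n D" "g = f X"
      by blast
    have "X (cs ! l) \<in> {0..<n}" if "l < N" for l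
    proof -
      have "cs ! l \<in> crossings D"
        using that lists by (metis nth_mem)
      then show ?thesis
        using X(1) unfolding fox_colourings_def by blast
    qed
    then show "g \<in> ?I \<rightarrow>\<^sub>E {0..<n}"
      by (auto simp: X(2) f_def)
  qed
  ultimately have "card (fox_colourings n D) \<le> card (?I \<rightarrow>\<^sub>E {0..<n})"
    by (intro card_inj_on_le) (auto intro: finite_PiE)
  also have "\<dots> = nat n ^ card ?I"
    by (simp add: card_PiE)
  also have "card ?I = d + 1"
    using lists by simp
  finally show ?thesis .
qed

end

section \<open>Distinguishing the knots\<close>

text \<open>
  The lists \<open>bs\<close> and \<open>es\<close> are Fox colourings modulo \<open>p\<close>, with the colour of arc \<open>c\<close> at index \<open>c - 1\<close>.
  Together with the constants they give the colourings \<open>x + q (y b + z e)\<close> modulo \<open>n = p q\<close>, where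
  \<open>q = 1\<close> except for \<open>n = 6\<close>.
\<close>

definition solution_check :: "int \<Rightarrow> gauss \<Rightarrow> int list \<Rightarrow> int list \<Rightarrow> bool" where
  "solution_check p D bs es \<longleftrightarrow>
     list_all (\<lambda>(l, c, s). let i = arc_into D (find_passage D Under c); j = arc_into D (find_passage D Over c)
       in list_all (\<lambda>xs. p dvd 2 * xs ! (j - 1) - xs ! (i - 1) - xs ! (c - 1)) [bs, es]) D \<and>
     list_all (\<lambda>be. list_ex (\<lambda>(l, c, s). (bs ! (c - 1), es ! (c - 1)) = be) D) [(0, 0), (1, 0), (0, 1)]"

text \<open>The three prescribed pairs of values (0, 0), (1, 0), (0, 1) occur at some crossings, and
  there the colours are \<open>x\<close>, \<open>x + q * y\<close> and \<open>x + q * z\<close>.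
  Hence the parameters can be read off, and different ones give different colourings.\<close>

lemma solution_check_card:
  assumes D: "valid_code D" and check: "solution_check p D bs es" and p: "p > 0" and n: "n = p * q" "q > 0"
  shows "nat (n * p * p) \<le> card (fox_colourings n D)"
proof -
  define \<beta> where "\<beta> = (\<lambda>c. bs ! (c - 1))"
  define \<gamma> where "\<gamma> = (\<lambda>c. es ! (c - 1))"
  define X where "X = (\<lambda>(x, y, z). restrict (\<lambda>c. (x + q * (y * \<beta> c + z * \<gamma> c)) mod n) (crossings D))"
  let ?S = "{0..<n} \<times> {0..<p} \<times> {0..<p}"
  have rel: "p dvd 2 * \<beta> (over_arc D c) - \<beta> (under_in D c) - \<beta> c"
    "p dvd 2 * \<gamma> (over_arc D c) - \<gamma> (under_in D c) - \<gamma> c" if c: "c \<in> crossings D" for c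
  proof -
    obtain l s where "(l, c, s) \<in> set D"
      using c by (auto simp: crossings_def)
    then show "p dvd 2 * \<beta> (over_arc D c) - \<beta> (under_in D c) - \<beta> c"
      "p dvd 2 * \<gamma> (over_arc D c) - \<gamma> (under_in D c) - \<gamma> c"
      using check find_passage_eq[OF D c]
      unfolding solution_check_def \<beta>_def \<gamma>_def under_in_def over_arc_def
      by (fastforce simp: list_all_iff Let_def)+
  qed
  have ex: "\<exists>c\<in>crossings D. \<beta> c = b \<and> \<gamma> c = e" if be: "(b, e) \<in> {(0, 0), (1, 0), (0, 1)}" for b e
  proof -
    have "list_ex (\<lambda>(l, c, s). (bs ! (c - 1), es ! (c - 1)) = (b, e)) D"
      using check be unfolding solution_check_def by auto
    then obtain l c s where lcs: "(l, c, s) \<in> set D" "bs ! (c - 1) = b" "es ! (c - 1) = e"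
      by (auto simp: list_ex_iff)
    then have "c \<in> crossings D"
      unfolding crossings_def by force
    then show ?thesis
      using lcs by (auto simp: \<beta>_def \<gamma>_def)
  qed
  have "inj_on X ?S"
  proof (rule inj_onI)
    fix u v assume uv: "u \<in> ?S" "v \<in> ?S" and "X u = X v"
    obtain x y z x' y' z' where eqs: "u = (x, y, z)" "v = (x', y', z')"
      by (cases u, cases v)
    then have ran: "x \<in> {0..<n}" "y \<in> {0..<p}" "z \<in> {0..<p}" "x' \<in> {0..<n}" "y' \<in> {0..<p}" "z' \<in> {0..<p}"
      and eq: "X (x, y, z) = X (x', y', z')"
      using uv \<open>X u = X v\<close> by auto
    have mod: "(x + q * (y * b + z * e)) mod n = (x' + q * (y' * b + z' * e)) mod n"
      if be: "(b, e) \<in> {(0, 0), (1, 0), (0, 1)}" for b e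
    proof -
      obtain c where "c \<in> crossings D" "\<beta> c = b" "\<gamma> c = e"
        using ex[OF be] by blast
      then show ?thesis
        using fun_cong[OF eq, of c] by (simp add: X_def)
    qed
    have x: "x = x'"
      using mod[of 0 0] ran by simp
    \<comment> \<open>As n = p q, the residue of \<open>q * u\<close> modulo \<open>n\<close>
      determines \<open>u\<close> modulo \<open>p\<close>.\<close>
    have cancel: "u = u'" if "(x + q * u) mod n = (x + q * u') mod n" "u \<in> {0..<p}" "u' \<in> {0..<p}" for u u'
    proof -
      have "q * p dvd q * (u - u')"
        using that(1) n(1) by (simp add: mod_eq_dvd_iff algebra_simps)
      then have "u mod p = u' mod p"
        using n(2) by (simp add: mod_eq_dvd_iff)
      then show ?thesis
        using that by simp
    qed
    have "y = y'"
      by (rule cancel) (use mod[of 1 0] x ran in simp_all)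
    moreover have "z = z'"
      by (rule cancel) (use mod[of 0 1] x ran in simp_all)
    ultimately show "u = v"
      using x by (simp add: eqs)
  qed
  moreover have "X ` ?S \<subseteq> fox_colourings n D"
  proof clarify
    fix x y z
    have npos: "n > 0"
      using p n by simp
    show "X (x, y, z) \<in> fox_colourings n D"
      unfolding fox_colourings_def
    proof (intro CollectI conjI ballI)
      show "X (x, y, z) \<in> crossings D \<rightarrow>\<^sub>E {0..<n}"
        using npos by (auto simp: X_def)
      fix c assume c: "c \<in> crossings D"
      have arcs: "over_arc D c \<in> crossings D" "under_in D c \<in> crossings D"
        using arc_into_crossing[OF D] unfolding under_in_def over_arc_def by blast+
      let ?v = "\<lambda>a. x + q * (y * \<beta> a + z * \<gamma> a)"
      \<comment> \<open>A relation modulo \<open>p\<close> becomes one modulo \<open>n\<close> after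
        multiplication by \<open>q\<close>; the constant \<open>x\<close> satisfies the Fox relation
        exactly and drops out.\<close>
      have "p dvd y * (2 * \<beta> (over_arc D c) - \<beta> (under_in D c) - \<beta> c)
          + z * (2 * \<gamma> (over_arc D c) - \<gamma> (under_in D c) - \<gamma> c)"
        using rel[OF c] by simp
      then have "q * p dvd q * (y * (2 * \<beta> (over_arc D c) - \<beta> (under_in D c) - \<beta> c)
          + z * (2 * \<gamma> (over_arc D c) - \<gamma> (under_in D c) - \<gamma> c))"
        by (rule mult_dvd_mono[OF dvd_refl])
      also have "q * (y * (2 * \<beta> (over_arc D c) - \<beta> (under_in D c) - \<beta> c)
          + z * (2 * \<gamma> (over_arc D c) - \<gamma> (under_in D c) - \<gamma> c))
        = 2 * ?v (over_arc D c) - ?v (under_in D c) - ?v c"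
        by (simp add: algebra_simps)
      finally have "(2 * ?v (over_arc D c) - ?v (under_in D c)) mod n = ?v c mod n"
        by (simp add: n mod_eq_dvd_iff mult.commute)
      moreover have "(2 * ?v (over_arc D c) - ?v (under_in D c)) mod n
          = (2 * (?v (over_arc D c) mod n) - ?v (under_in D c) mod n) mod n"
        by (intro mod_diff_cong mod_mult_cong) simp_all
      ultimately show "X (x, y, z) c = (2 * X (x, y, z) (over_arc D c) - X (x, y, z) (under_in D c)) mod n"
        using c arcs by (simp add: X_def)
    qed
  qed
  moreover have "finite (fox_colourings n D)"
    by (rule finite_subset[of _ "crossings D \<rightarrow>\<^sub>E {0..<n}"])
      (auto simp: fox_colourings_def intro: finite_PiE)
  ultimately have "card ?S \<le> card (fox_colourings n D)"
    by (rule card_inj_on_le)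
  then show ?thesis
    using p n by (simp add: card_cartesian_product nat_mult_distrib)
qed

lemma card_colourings_knot:
  assumes D: "valid_code D" and K: "D' \<in> knot D" and n: "n \<ge> 1" "n dvd m + 1"
  shows "card (colourings n m D') = card (fox_colourings n D)"
proof -
  have "valid_code D'"
    using K knot_diagram_valid by (simp add: knot_def)
  then show ?thesis
    using card_fox_colourings D card_loops_knot[OF K] colourings_eq_fox(2)[OF n] by simp
qed

text \<open>The condition \<open>n < p * p\<close> separates the counts: n^2 for the first knot
  against n p^2 for the second. It holds with p = n for n = 3 and n = 5, and with p = 3 for n =
  6.\<close>

lemma pair_check:
  assumes I: "reduction_check 1 D rs cs ops \<alpha>" and II: "reduction_check 2 D' rs' cs' ops' \<alpha>"
    and sol: "solution_check p D' bs es" and p: "p > 0" "n = p * q" "q > 0" "n < p * p" "n dvd m + 1"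
  shows "same_alexander_polynomial (knot D) (knot D') \<and> type_I (knot D) \<and> type_II (knot D') \<and>
    distinguishes n m (knot D) (knot D')"
proof -
  have n: "n \<ge> 1"
    using p by (metis int_one_le_iff_zero_less zero_less_mult_iff)
  have "card (fox_colourings n D) \<le> nat (n * n)"
    using check_card_fox_colourings[OF I, of n] n by (simp add: nat_mult_distrib)
  also have "\<dots> < nat (n * (p * p))"
    using n p by (simp add: zless_nat_eq_int_zless)
  also have "\<dots> \<le> card (fox_colourings n D')"
    using solution_check_card[OF check_diagram(2)[OF II] sol p(1,2,3)] by (simp add: mult.assoc)
  finally have less: "card (fox_colourings n D) < card (fox_colourings n D')" .
  have "distinguishes n m (knot D) (knot D')"
    unfolding distinguishes_def
    using n less colourings_eq_fox(1)[OF n p(5)]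
      card_colourings_knot[OF check_diagram(2)[OF I] _ n p(5)]
      card_colourings_knot[OF check_diagram(2)[OF II] _ n p(5)] by auto
  moreover have "same_alexander_polynomial (knot D) (knot D')"
    unfolding same_alexander_polynomial_def using check_alexander[OF I] check_alexander[OF II] by blast
  ultimately show ?thesis
    using check_type_I[OF I] check_type_II[OF II] by simp
qed

section \<open>The certificates for the eight pairs\<close>

lemma pair_6_1_9_46:
  "same_alexander_polynomial knot_6_1 knot_9_46 \<and> type_I knot_6_1 \<and> type_II knot_9_46 \<and>
   distinguishes 3 2 knot_6_1 knot_9_46"
  unfolding knot_6_1_def knot_9_46_def
\<comment> \<open>Here \<open>\<alpha>\<close> stands for 2 - 5 m + 2 m^2. The orders
  \<open>rs\<close> and \<open>cs\<close> bring the pivots onto the diagonal, so that no exchanges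
  occur among the operations. In this and the following pairs, the first N - 1 operations of each
  list add all other rows, weighted by powers of \<open>m\<close>, to the last row, which becomes
  zero; the remaining ones clear the entries below the diagonal. \<open>bs\<close> and
  \<open>es\<close> solve the Fox relations modulo \<open>p\<close>, normalised at three
  arcs.\<close>
proof (rule pair_check[where \<alpha> = "[2, -5, 2]" and p = 3 and q = 1
      and rs = "[4, 5, 2, 6, 1, 3]" and cs = "[3, 5, 6, 4, 1, 2]"
      and ops = "[(5, [0, 1], [1], 4), (5, [1], [0, 1], 2), (5, [1], [1], 0), (5, [1], [1], 1),
      (5, [1], [1], 3), (4, [1], [1, -1], 0), (4, [1], [2, -1], 1), (3, [1], [1], 2),
      (4, [1], [2, -2], 3)]"
      and rs' = "[8, 5, 1, 9, 7, 2, 6, 3, 4]" and cs' = "[8, 4, 1, 6, 5, 2, 9, 3, 7]"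
      and ops' = "[(8, [1], [1], 2), (8, [1], [1], 5), (8, [1], [1], 7), (8, [1], [1], 1),
      (8, [1], [1], 6), (8, [1], [1], 4), (8, [1], [1], 0), (8, [1], [1], 3),
      (7, [1], [1], 0), (3, [0, 1], [-1, 1], 0), (5, [1], [1], 2), (6, [1], [1], 3),
      (6, [1], [1, -1], 4), (7, [1], [1, -1], 5)]"
      and bs = "[1, 1, 1, 1, 0, 2, 2, 1, 0]" and es = "[0, 2, 1, 1, 0, 2, 2, 0, 1]"])
qed (code_simp, code_simp, code_simp, simp_all)

lemma pair_8_9_10_155:
  "same_alexander_polynomial knot_8_9 knot_10_155 \<and> type_I knot_8_9 \<and> type_II knot_10_155 \<and>
   distinguishes 5 4 knot_8_9 knot_10_155"
  unfolding knot_8_9_def knot_10_155_def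
proof (rule pair_check[where \<alpha> = "[1, -3, 5, -7, 5, -3, 1]" and p = 5 and q = 1
      and rs = "[6, 7, 5, 3, 4, 2, 8, 1]" and cs = "[6, 7, 5, 1, 2, 8, 3, 4]"
      and ops = "[(7, [0, 1], [1], 5), (7, [1], [1], 3), (7, [1], [1], 4), (7, [1], [1], 2),
      (7, [1], [0, 1], 0), (7, [1], [0, 1], 1), (7, [1], [0, 1], 6), (1, [1], [1, -1], 0),
      (6, [1], [0, 1], 1), (6, [1], [1, -1, 1], 2), (5, [1], [1, -1], 3),
      (5, [1], [1, -1, 1], 4), (6, [1], [2, -2, 2, -1], 5)]"
      and rs' = "[2, 6, 8, 5, 10, 4, 3, 9, 7, 1]" and cs' = "[1, 6, 8, 4, 10, 2, 7, 9, 3, 5]"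
      and ops' = "[(9, [1], [0, 1], 0), (9, [1], [0, 1], 6), (9, [1], [0, 1], 5), (9, [1], [0, 1], 3),
      (9, [1], [0, 1], 1), (9, [1], [0, 1], 8), (9, [1], [0, 1], 2), (9, [1], [1], 7),
      (9, [1], [1], 4), (4, [1], [-1, 1], 1), (7, [1], [1], 2), (5, [1], [1], 3),
      (8, [0, 1], [1, -1], 4), (7, [1], [1], 4), (6, [1], [1, -1], 5), (8, [1], [0, 1], 6),
      (7, [1], [-1, 1], 6)]"
      and bs = "[1, 4, 3, 2, 0, 4, 0, 0, 1, 0]" and es = "[2, 4, 0, 1, 4, 3, 3, 0, 0, 1]"])
qed (code_simp, code_simp, code_simp, simp_all)

lemma pair_9_24_8_18:
  "same_alexander_polynomial knot_9_24 knot_8_18 \<and> type_I knot_9_24 \<and> type_II knot_8_18 \<and>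
   distinguishes 6 5 knot_9_24 knot_8_18"
  unfolding knot_9_24_def knot_8_18_def
\<comment> \<open>At m = -1 the polynomial takes the value 45, which is divisible by 3 but odd. The
  nonconstant solutions are therefore taken modulo 3 and doubled to give colourings modulo
  6.\<close>
proof (rule pair_check[where \<alpha> = "[1, -5, 10, -13, 10, -5, 1]" and p = 3 and q = 2
      and rs = "[8, 1, 2, 4, 3, 7, 6, 9, 5]" and cs = "[8, 5, 2, 7, 1, 6, 3, 4, 9]"
      and ops = "[(8, [1], [1], 1), (8, [1], [1], 2), (8, [1], [0, 1], 4), (8, [1], [0, 1], 3),
      (8, [1], [1], 6), (8, [1], [0, 1], 5), (8, [1], [0, 1], 0), (8, [1], [0, 1], 7),
      (7, [0, 1], [-1, 1], 0), (6, [0, 1], [-1, 1], 1), (6, [1], [0, 0, 1], 2),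
      (5, [1], [0, 1], 3), (7, [1], [-1, 2, -1], 3), (6, [1], [-1, 1, -1, 1], 4),
      (6, [1], [1, -1, 1], 5), (7, [0, 0, 1], [-1, 3, -3, 1], 6)]"
      and rs' = "[8, 7, 5, 4, 1, 3, 2, 6]" and cs' = "[8, 6, 5, 4, 2, 3, 1, 7]"
      and ops' = "[(7, [0, 1], [1], 4), (7, [1], [1], 6), (7, [1], [0, 1], 5), (7, [1], [0, 1], 3),
      (7, [1], [1], 2), (7, [1], [1], 1), (7, [1], [0, 1], 0), (6, [1], [1], 0),
      (5, [0, 1], [1, -1], 1), (4, [1], [1, -1], 2), (4, [1], [1], 3),
      (6, [0, 1], [-1, 1], 3), (6, [1], [1], 4), (5, [1], [-1, 2, -1], 4)]"
      and bs = "[1, 2, 2, 2, 0, 0, 1, 0]" and es = "[2, 0, 1, 2, 2, 0, 0, 1]"])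
qed (code_simp, code_simp, code_simp, simp_all)

lemma pair_10_40_10_103:
  "same_alexander_polynomial knot_10_40 knot_10_103 \<and> type_I knot_10_40 \<and> type_II knot_10_103 \<and>
   distinguishes 5 4 knot_10_40 knot_10_103"
  unfolding knot_10_40_def knot_10_103_def
proof (rule pair_check[where \<alpha> = "[2, -8, 17, -21, 17, -8, 2]" and p = 5 and q = 1
      and rs = "[8, 6, 7, 4, 5, 3, 10, 2, 9, 1]" and cs = "[9, 6, 7, 8, 5, 1, 10, 4, 2, 3]"
      and ops = "[(9, [0, 1], [1], 7), (9, [1], [1], 5), (9, [1], [0, 1], 3), (9, [1], [0, 1], 4),
      (9, [1], [0, 1], 1), (9, [1], [0, 1], 2), (9, [1], [0, 1], 0), (9, [1], [0, 1], 8),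
      (9, [1], [1], 6), (8, [0, 1], [1], 0), (8, [1], [0, 1, -1], 1), (8, [1], [1, -1, 1], 2),
      (8, [1], [2, -2, 1], 3), (8, [1], [0, 2, -3, 2], 4), (7, [1], [1, -1], 5),
      (8, [1], [2, -4, 4, -2], 6), (8, [1], [4, -8, 9, -6, 2], 7)]"
      and rs' = "[2, 8, 9, 5, 10, 4, 7, 3, 1, 6]" and cs' = "[5, 8, 6, 2, 10, 7, 9, 1, 3, 4]"
      and ops' = "[(9, [0, 1], [1], 8), (9, [1], [0, 1], 0), (9, [1], [0, 1], 7), (9, [1], [1], 5),
      (9, [1], [1], 3), (9, [1], [1], 6), (9, [1], [1], 1), (9, [1], [1], 2),
      (9, [1], [1], 4), (3, [1], [1], 0), (7, [0, 1], [1, -1], 1), (8, [1], [1, -1], 2),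
      (7, [1], [1, -1], 3), (6, [1], [-1, 1], 3), (8, [1], [2, -1], 4),
      (7, [1], [1, -2, 1], 5), (6, [1], [0, 1], 5), (8, [1], [2, -2], 6),
      (8, [1], [2, -1], 7)]"
      and bs = "[3, 4, 2, 2, 2, 4, 2, 0, 1, 0]" and es = "[3, 0, 2, 4, 1, 2, 0, 0, 0, 1]"])
qed (code_simp, code_simp, code_simp, simp_all)

lemma pair_10_42_10_75:
  "same_alexander_polynomial knot_10_42 knot_10_75 \<and> type_I knot_10_42 \<and> type_II knot_10_75 \<and>
   distinguishes 3 2 knot_10_42 knot_10_75"
  unfolding knot_10_42_def knot_10_75_def
proof (rule pair_check[where \<alpha> = "[1, -7, 19, -27, 19, -7, 1]" and p = 3 and q = 1
      and rs = "[8, 6, 3, 9, 5, 10, 4, 2, 7, 1]" and cs = "[7, 8, 1, 9, 5, 10, 6, 4, 2, 3]"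
      and ops = "[(9, [0, 1], [1], 7), (9, [1], [1], 2), (9, [1], [0, 1], 6), (9, [1], [0, 1], 4),
      (9, [1], [1], 1), (9, [1], [1], 8), (9, [1], [0, 1], 0), (9, [1], [0, 1], 3),
      (9, [1], [1], 5), (8, [1], [1], 0), (8, [1], [2, -1], 1), (7, [1], [1, -1], 2),
      (8, [1], [1, -1], 3), (8, [1], [-1, 3, -1], 4), (8, [0, 1], [-1, 5, -5, 1], 5),
      (8, [1], [-1, 4, -2], 6), (8, [1], [-2, 10, -12, 6, -1], 7)]"
      and rs' = "[1, 4, 10, 8, 7, 3, 6, 5, 9, 2]" and cs' = "[1, 2, 10, 6, 7, 3, 5, 8, 4, 9]"
      and ops' = "[(9, [1], [0, 1], 0), (9, [1], [1], 5), (9, [1], [0, 1], 1), (9, [1], [0, 1], 7),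
      (9, [1], [1], 6), (9, [1], [0, 1], 4), (9, [1], [0, 1], 3), (9, [1], [1], 8),
      (9, [1], [0, 1], 2), (5, [1], [1], 0), (7, [0, 1], [-1, 1], 1), (8, [1], [-1, 1], 2),
      (6, [1], [1], 3), (4, [0, 1], [-1, 1], 3), (5, [1], [1], 4),
      (8, [0, 1], [-1, 2, -1], 4), (7, [0, 1], [-1, 2], 5), (7, [1], [-1, 3, -1], 6),
      (8, [1], [1], 7)]"
      and bs = "[0, 0, 2, 1, 1, 0, 2, 2, 1, 0]" and es = "[1, 1, 1, 1, 1, 0, 2, 2, 0, 1]"])
qed (code_simp, code_simp, code_simp, simp_all)

lemma pair_10_59_9_40:
  "same_alexander_polynomial knot_10_59 knot_9_40 \<and> type_I knot_10_59 \<and> type_II knot_9_40 \<and>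
   distinguishes 5 4 knot_10_59 knot_9_40"
  unfolding knot_10_59_def knot_9_40_def
proof (rule pair_check[where \<alpha> = "[1, -7, 18, -23, 18, -7, 1]" and p = 5 and q = 1
      and rs = "[10, 7, 2, 1, 4, 5, 3, 6, 8, 9]" and cs = "[8, 7, 10, 9, 4, 5, 1, 3, 2, 6]"
      and ops = "[(9, [1], [0, 1], 3), (9, [1], [0, 1], 2), (9, [1], [0, 1], 6), (9, [1], [1], 4),
      (9, [1], [1], 5), (9, [1], [0, 1], 7), (9, [1], [0, 1], 1), (9, [1], [0, 1], 8),
      (9, [1], [1], 0), (8, [1], [1], 0), (8, [1], [-1, 1], 1), (8, [0, 1], [-1, 2], 2),
      (7, [0, 1], [-1, 1], 3), (8, [1], [-1, 3, -1], 4), (7, [0, 1], [-1, 2], 5),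
      (7, [1], [-1, 1], 6), (8, [0, 1], [1, -3, 2], 6), (8, [0, 1], [1, -4, 6, -4, 1], 7)]"
      and rs' = "[9, 4, 3, 5, 8, 1, 7, 2, 6]" and cs' = "[2, 6, 1, 5, 9, 7, 3, 4, 8]"
      and ops' = "[(8, [1], [1], 5), (8, [1], [0, 1], 7), (8, [1], [0, 0, 1], 2), (8, [1], [0, 0, 1], 1),
      (8, [1], [0, 1], 3), (8, [1], [0, 1], 6), (8, [1], [0, 0, 1], 4), (8, [1], [1], 0),
      (7, [1], [1], 0), (6, [1], [-1, 1], 1), (5, [1], [0, 1], 2), (7, [1], [-1, 1], 2),
      (5, [1], [-1, 1], 3), (5, [1], [1, -2, 1], 4), (7, [1], [0, 1], 4),
      (7, [1], [1, -1], 5), (6, [1], [1], 5)]"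
      and bs = "[4, 0, 3, 3, 2, 3, 0, 1, 0]" and es = "[1, 4, 4, 3, 3, 0, 0, 0, 1]"])
qed (code_simp, code_simp, code_simp, simp_all)

lemma pair_10_67_10_74:
  "same_alexander_polynomial knot_10_67 knot_10_74 \<and> type_I knot_10_67 \<and> type_II knot_10_74 \<and>
   distinguishes 3 2 knot_10_67 knot_10_74"
  unfolding knot_10_67_def knot_10_74_def
proof (rule pair_check[where \<alpha> = "[4, -16, 23, -16, 4]" and p = 3 and q = 1
      and rs = "[2, 8, 5, 6, 1, 7, 9, 10, 4, 3]" and cs = "[10, 8, 3, 6, 1, 5, 9, 7, 2, 4]"
      and ops = "[(9, [0, 1], [1], 4), (9, [1], [0, 1], 0), (9, [1], [1], 8), (9, [1], [1], 2),
      (9, [1], [1], 3), (9, [1], [1], 5), (9, [1], [1], 1), (9, [1], [1], 6),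
      (9, [1], [1], 7), (7, [1], [1], 0), (5, [0, 1], [-1, 1], 1), (7, [0, 1], [1], 1),
      (8, [1], [1, -1], 2), (8, [1], [2, -1], 3), (7, [1], [1, -1], 4),
      (8, [0, 1], [2, -2], 5), (8, [0, 1], [-2, 4, -2], 6), (7, [1], [2, -1], 6),
      (8, [1], [2, -6, 8, -4], 7)]"
      and rs' = "[4, 9, 10, 6, 2, 5, 3, 1, 7, 8]" and cs' = "[4, 8, 10, 6, 9, 3, 1, 5, 2, 7]"
      and ops' = "[(9, [1], [1], 7), (9, [1], [1], 4), (9, [1], [1], 6), (9, [1], [0, 1], 0),
      (9, [1], [0, 1], 5), (9, [1], [1], 3), (9, [1], [1], 8), (9, [1], [1], 1),
      (9, [1], [1], 2), (8, [1], [1], 0), (7, [1], [1, -1], 1), (7, [1], [2, -1], 2),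
      (8, [0, 1], [-1, 1], 3), (7, [1], [2, -2], 4), (6, [1], [1], 5), (8, [1], [-1, 1], 5),
      (7, [1], [2, -3, 2], 6)]"
      and bs = "[1, 1, 1, 1, 1, 0, 2, 2, 1, 0]" and es = "[0, 0, 2, 1, 1, 0, 2, 2, 0, 1]"])
qed (code_simp, code_simp, code_simp, simp_all)

lemma pair_10_87_10_98:
  "same_alexander_polynomial knot_10_87 knot_10_98 \<and> type_I knot_10_87 \<and> type_II knot_10_98 \<and>
   distinguishes 3 2 knot_10_87 knot_10_98"
  unfolding knot_10_87_def knot_10_98_def
proof (rule pair_check[where \<alpha> = "[2, -9, 18, -23, 18, -9, 2]" and p = 3 and q = 1
      and rs = "[6, 5, 8, 10, 3, 9, 1, 2, 7, 4]" and cs = "[6, 3, 4, 7, 5, 9, 10, 8, 1, 2]"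
      and ops = "[(9, [1], [0, 1], 6), (9, [1], [1], 7), (9, [1], [1], 4), (9, [1], [1], 1),
      (9, [1], [0, 1], 0), (9, [1], [0, 1], 8), (9, [1], [0, 1], 2), (9, [1], [0, 1], 5),
      (9, [1], [0, 1], 3), (4, [1], [-1, 1], 0), (4, [1], [0, 1], 1), (8, [0, 1], [-1, 1], 2),
      (8, [0, 1], [1, -1, 1], 3), (6, [0, 1], [1, -1], 4), (8, [1], [1, -2, 2], 5),
      (8, [0, 1], [2, -3, 2], 6), (8, [1], [0, 2, -8, 11, -7, 2], 7)]"
      and rs' = "[8, 7, 6, 1, 4, 5, 2, 3, 10, 9]" and cs' = "[2, 7, 6, 8, 9, 3, 1, 5, 4, 10]"
      and ops' = "[(9, [0, 1], [1], 3), (9, [1], [1], 6), (9, [1], [1], 7), (9, [1], [1], 4),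
      (9, [1], [1], 5), (9, [1], [1], 2), (9, [1], [1], 1), (9, [1], [0, 1], 0),
      (9, [1], [1], 8), (6, [1], [1], 0), (6, [0, 1], [1, -1], 1), (6, [1], [1], 2),
      (5, [0, 1], [-1, 1], 2), (6, [1], [0, 1], 3), (8, [1], [1, -1], 3),
      (7, [1], [1, -1], 4), (7, [0, 1], [1, -1, 1], 5), (7, [1], [1], 6),
      (8, [1], [-1, 1], 6)]"
      and bs = "[2, 2, 0, 2, 1, 2, 0, 1, 1, 0]" and es = "[2, 0, 1, 2, 1, 1, 0, 0, 0, 1]"])
qed (code_simp, code_simp, code_simp, simp_all)

theorem proposition16:
  shows "\<forall>(K, K', n, m) \<in>
      {(knot_6_1, knot_9_46, 3, 2),
       (knot_8_9, knot_10_155, 5, 4),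
       (knot_9_24, knot_8_18, 6, 5),
       (knot_10_40, knot_10_103, 5, 4),
       (knot_10_42, knot_10_75, 3, 2),
       (knot_10_59, knot_9_40, 5, 4),
       (knot_10_67, knot_10_74, 3, 2),
       (knot_10_87, knot_10_98, 3, 2)}.
    same_alexander_polynomial K K' \<and> type_I K \<and> type_II K' \<and> distinguishes n m K K'"
  using pair_6_1_9_46 pair_8_9_10_155 pair_9_24_8_18 pair_10_40_10_103 pair_10_42_10_75
    pair_10_59_9_40 pair_10_67_10_74 pair_10_87_10_98
  by simp

end
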